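(* Let $f\in\mathbb{C}[z_1,\dots,z_n]$ be a nonzero homogeneous polynomial. Then: (1) $\mathcal V_{\mathbb R}(f)\subseteq\mathcal I(f)$, with equality if and only if there is $\phi\in[0,2\pi)$ such that $e^{i\phi}f$ is a product of linear polynomials with real coefficients. (2) If $f$ is hyperbolic (in some direction) and irreducible, then the Zariski closure in $\mathbb{C}^n$ of the boundary $\partial\big(\mathbb{R}^n\setminus\mathcal I(f)\big)$ equals $\mathcal V(f)$.
   Context: For $f\in\mathbb{C}[z_1,\dots,z_n]$, $\mathcal{V}(f)\subseteq\mathbb{C}^n$ denotes its complex zero set, $\mathcal V_{\mathbb R}(f)=\mathcal V(f)\cap\mathbb{R}^n$ its real zero set, and the imaginary projection of $f$ is $\mathcal{I}(f)=\{\Im(\mathbf z):\mathbf z\in\mathcal V(f)\}\subseteq\mathbb{R}^n$, where $\Im$ is taken componentwise. A homogeneous polynomial $f$ is hyperbolic in direction $\mathbf e\in\mathbb{R}^n$ if $f(\mathbf e)\neq 0$ and for every $\mathbf x\in\mathbb{R}^n$ the univariate polynomial $t\mapsto f(\mathbf x+t\mathbf e)$ has only real roots. *)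

theory Defs
  imports "HOL-Analysis.Analysis" "HOL-Library.Poly_Mapping"
begin

text \<open>Multivariate complex polynomials in the variables indexed by the finite type 'n:
  finitely supported maps from exponent vectors (monomials) to coefficients.
  This carries the convolution ring structure (comm_ring_1) of Poly_Mapping.\<close>
type_synonym 'n cpoly = "('n \<Rightarrow>\<^sub>0 nat) \<Rightarrow>\<^sub>0 complex"

definition mono_deg :: "('n::finite \<Rightarrow>\<^sub>0 nat) \<Rightarrow> nat" where
  "mono_deg m = (\<Sum>i\<in>UNIV. Poly_Mapping.lookup m i)"

definition peval :: "'n::finite cpoly \<Rightarrow> complex ^ 'n \<Rightarrow> complex" where
  "peval p z = (\<Sum>m\<in>Poly_Mapping.keys p. Poly_Mapping.lookup p m * (\<Prod>i\<in>UNIV. (z $ i) ^ Poly_Mapping.lookup m i))"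

definition homogeneous :: "'n::finite cpoly \<Rightarrow> bool" where
  "homogeneous p \<longleftrightarrow> (\<exists>d. \<forall>m\<in>Poly_Mapping.keys p. mono_deg m = d)"

definition cconst :: "complex \<Rightarrow> 'n::finite cpoly" where
  "cconst c = Poly_Mapping.single 0 c"

definition real_linear_poly :: "'n::finite cpoly \<Rightarrow> bool" where
  "real_linear_poly l \<longleftrightarrow> (\<forall>m\<in>Poly_Mapping.keys l. mono_deg m \<le> 1) \<and> (\<forall>m. Poly_Mapping.lookup l m \<in> \<real>)"

definition cvec_of_real :: "real ^ 'n \<Rightarrow> complex ^ 'n" where
  "cvec_of_real x = (\<chi> i. complex_of_real (x $ i))"

definition Im_vec :: "complex ^ 'n \<Rightarrow> real ^ 'n" where
  "Im_vec z = (\<chi> i. Im (z $ i))"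

definition zero_set :: "'n::finite cpoly \<Rightarrow> (complex ^ 'n) set" where
  "zero_set f = {z. peval f z = 0}"

definition real_zero_set :: "'n::finite cpoly \<Rightarrow> (real ^ 'n) set" where
  "real_zero_set f = {x. peval f (cvec_of_real x) = 0}"

definition imag_proj :: "'n::finite cpoly \<Rightarrow> (real ^ 'n) set" where
  "imag_proj f = Im_vec ` zero_set f"

definition hyperbolic_dir :: "'n::finite cpoly \<Rightarrow> real ^ 'n \<Rightarrow> bool" where
  "hyperbolic_dir f e \<longleftrightarrow> homogeneous f \<and> peval f (cvec_of_real e) \<noteq> 0 \<and>
     (\<forall>x::real^'n. \<forall>t::complex.
        peval f (cvec_of_real x + t *s cvec_of_real e) = 0 \<longrightarrow> t \<in> \<real>)"

definition zariski_closure :: "(complex ^ 'n::finite) set \<Rightarrow> (complex ^ 'n) set" where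
  "zariski_closure S = {z. \<forall>p::'n cpoly. (\<forall>w\<in>S. peval p w = 0) \<longrightarrow> peval p z = 0}"

end

theory Submission
  imports Defs "HOL-Computational_Algebra.Fundamental_Theorem_Algebra"
begin

text \<open>
  If \<open>f\<close> is a product of real linear polynomials up to a phase, a zero \<open>z\<close> of \<open>f\<close> gives a factor \<open>l\<close> with
  \<open>l(-i z) = 0\<close>, and taking real parts \<open>l(Im z) = 0\<close>. Conversely, assume \<open>f(Im z) = 0\<close> for all zeros \<open>z\<close> of \<open>f\<close>.
  The inclusion of the imaginary projection in the real zero set of \<open>f\<close> passes to lowest-order terms at real points, so
  a form \<open>g\<close> of least positive degree with this property is invariant under translation by its real zeros.
  These form a hyperplane, on which \<open>f\<close> vanishes; one splits off the corresponding linear factor and inducts on the degree.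

  If \<open>f\<close> is hyperbolic, the complement of the imaginary projection consists of the hyperbolicity directions. It is
  open (Garding), and relatively closed where \<open>f \<noteq> 0\<close>, so its frontier \<open>S\<close> consists of zeros of \<open>f\<close>; moreover \<open>S\<close> meets
  every line in a hyperbolicity direction \<open>e\<close>. Let \<open>g(z,t)\<close> be a nonzero polynomial of least \<open>t\<close>-degree vanishing
  whenever \<open>z + t e \<in> S\<close>. If that degree is less than the degree of \<open>f\<close>, then \<open>a\<^sup>N f(z + t e) = g q\<close> for the leading coefficient
  \<open>a\<close> of \<open>g\<close>. The roots of \<open>f(z + t e)\<close> are locally bounded, hence so are the coefficients of \<open>g / a\<close>, and a locally
  bounded quotient of polynomials is a polynomial: \<open>f\<close> is reducible. Otherwise, division by \<open>f(z + t e)\<close>, which is monic in \<open>t\<close>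
  up to a constant, shows that \<open>f\<close> divides every polynomial vanishing on \<open>S\<close>.
\<close>

subsection \<open>Evaluation of multivariate polynomials\<close>

abbreviation lookup where "lookup \<equiv> Poly_Mapping.lookup"
abbreviation keys where "keys \<equiv> Poly_Mapping.keys"
abbreviation single where "single \<equiv> Poly_Mapping.single"

definition Var :: "'n::finite \<Rightarrow> 'n cpoly" where
  "Var i = single (single i 1) 1"

lemma peval_superset:
  assumes "finite A" "keys p \<subseteq> A"
  shows "peval p z = (\<Sum>m\<in>A. lookup p m * (\<Prod>i\<in>UNIV. (z $ i) ^ lookup m i))"
  unfolding peval_def using assms
  by (intro sum.mono_neutral_left) (auto simp: in_keys_iff)

lemma peval_add [simp]: "peval (p + q) z = peval p z + peval q z"
proof -
  let ?A = "keys p \<union> keys q"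
  have "keys (p + q) \<subseteq> ?A" by (rule Poly_Mapping.keys_add)
  then show ?thesis
    by (simp add: peval_superset[of ?A] lookup_add distrib_right sum.distrib)
qed

lemma peval_0 [simp]: "peval 0 z = 0"
  by (simp add: peval_def)

lemma peval_single: "peval (single m c) z = c * (\<Prod>i\<in>UNIV. (z $ i) ^ lookup m i)"
  by (simp add: peval_superset[of "{m}"])

lemma peval_sum [simp]: "peval (sum p A) z = (\<Sum>a\<in>A. peval (p a) z)"
  by (induction A rule: infinite_finite_induct) auto

lemma poly_mapping_sum_single: "p = (\<Sum>m\<in>keys p. single m (lookup p m))"
proof (rule poly_mapping_eqI)
  fix k
  have "(\<Sum>m\<in>keys p. lookup (single m (lookup p m)) k) = (\<Sum>m\<in>keys p. if m = k then lookup p k else 0)"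
    by (intro sum.cong) (auto simp: lookup_single)
  then show "lookup p k = lookup (\<Sum>m\<in>keys p. single m (lookup p m)) k"
    by (auto simp: lookup_sum in_keys_iff)
qed

lemma peval_mult [simp]: "peval (p * q) z = peval p z * peval q z"
proof -
  have "p * q = (\<Sum>m\<in>keys p. \<Sum>n\<in>keys q. single (m + n) (lookup p m * lookup q n))"
    by (subst (1) poly_mapping_sum_single[of p], subst (1) poly_mapping_sum_single[of q])
       (simp add: sum_product mult_single)
  then have "peval (p * q) z = (\<Sum>m\<in>keys p. \<Sum>n\<in>keys q.
      (lookup p m * (\<Prod>i\<in>UNIV. (z $ i) ^ lookup m i)) * (lookup q n * (\<Prod>i\<in>UNIV. (z $ i) ^ lookup n i)))"
    by (simp add: peval_single lookup_add power_add prod.distrib mult_ac)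
  then show ?thesis by (simp add: peval_def sum_product)
qed

lemma peval_cconst [simp]: "peval (cconst c) z = c"
  by (simp add: cconst_def peval_single)

lemma peval_Var [simp]: "peval (Var i) z = z $ i"
proof -
  have "(\<Prod>j\<in>UNIV. (z $ j) ^ lookup (single i (1::nat)) j) = (\<Prod>j\<in>UNIV. if j = i then z $ i else 1)"
    by (intro prod.cong) (auto simp: lookup_single)
  then show ?thesis by (simp add: Var_def peval_single)
qed

lemma peval_1 [simp]: "peval 1 z = 1"
  using peval_cconst[of 1 z] by (simp add: cconst_def)

lemma peval_uminus [simp]: "peval (- p) z = - peval p z"
  using peval_add[of p "- p" z] by (simp add: add_eq_0_iff)

lemma peval_diff [simp]: "peval (p - q) z = peval p z - peval q z"
  using peval_add[of p "- q" z] by simp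

lemma peval_prod [simp]: "peval (prod p A) z = (\<Prod>a\<in>A. peval (p a) z)"
  by (induction A rule: infinite_finite_induct) auto

lemma peval_prod_list [simp]: "peval (prod_list ps) z = (\<Prod>p\<leftarrow>ps. peval p z)"
  by (induction ps) auto

lemma peval_power [simp]: "peval (p ^ n) z = peval p z ^ n"
  by (induction n) auto

lemma tendsto_peval [tendsto_intros]:
  assumes "(g \<longlongrightarrow> z) F"
  shows "((\<lambda>x. peval p (g x)) \<longlongrightarrow> peval p z) F"
  unfolding peval_def using assms by (intro tendsto_intros)

text \<open>Kronecker substitution: positional weights separate any finite set of monomials.\<close>

lemma separating_weights:
  fixes M :: "('n::finite \<Rightarrow>\<^sub>0 nat) set"
  assumes "finite M"
  obtains w :: "'n \<Rightarrow> nat" where "inj_on (\<lambda>m. \<Sum>i\<in>UNIV. w i * lookup m i) M"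
proof -
  have "\<exists>w :: 'n \<Rightarrow> nat. \<forall>m\<in>M. \<forall>m'\<in>M. (\<Sum>i\<in>V. w i * lookup m i) = (\<Sum>i\<in>V. w i * lookup m' i) \<longrightarrow>
      (\<forall>i\<in>V. lookup m i = lookup m' i)" if "finite V" for V
    using that
  proof induction
    case (insert j V)
    then obtain w where w: "\<forall>m\<in>M. \<forall>m'\<in>M. (\<Sum>i\<in>V. w i * lookup m i) = (\<Sum>i\<in>V. w i * lookup m' i) \<longrightarrow>
      (\<forall>i\<in>V. lookup m i = lookup m' i)" by blast
    define s where "s m = (\<Sum>i\<in>V. w i * lookup m i)" for m
    \<comment> \<open>As \<open>B\<close> exceeds all old weighted sums on \<open>M\<close>, it can
      serve as the weight of \<open>j\<close>: the quotient of the new sum by \<open>B\<close> is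
      the exponent of \<open>j\<close>, and the remainder is the old sum.\<close>
    define B where "B = Suc (Max (s ` M))"
    have sB: "s m < B" if "m \<in> M" for m
      unfolding B_def using that assms by (simp add: le_imp_less_Suc)
    define w' where "w' = w(j := B)"
    have sum': "(\<Sum>i\<in>insert j V. w' i * lookup m i) = B * lookup m j + s m" for m
    proof -
      have "(\<Sum>i\<in>V. w' i * lookup m i) = s m"
        unfolding s_def w'_def using insert.hyps by (intro sum.cong) auto
      then show ?thesis using insert.hyps by (simp add: w'_def)
    qed
    have "\<forall>i\<in>insert j V. lookup m i = lookup m' i"
      if m: "m \<in> M" "m' \<in> M" and eq: "B * lookup m j + s m = B * lookup m' j + s m'" for m m'
    proof -
      have "(B * lookup m j + s m) div B = lookup m j" "(B * lookup m' j + s m') div B = lookup m' j"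
        using sB[OF m(1)] sB[OF m(2)] by simp_all
      then have j: "lookup m j = lookup m' j" using eq by metis
      then have "s m = s m'" using eq by simp
      then have "\<forall>i\<in>V. lookup m i = lookup m' i" using w m unfolding s_def by blast
      then show ?thesis using j by blast
    qed
    then show ?case unfolding sum'[symmetric] by blast
  qed auto
  from this[of UNIV] obtain w :: "'n \<Rightarrow> nat" where
    w: "\<forall>m\<in>M. \<forall>m'\<in>M. (\<Sum>i\<in>UNIV. w i * lookup m i) = (\<Sum>i\<in>UNIV. w i * lookup m' i) \<longrightarrow>
      (\<forall>i. lookup m i = lookup m' i)" by auto
  show ?thesis
    by (rule that[of w], rule inj_onI, rule poly_mapping_eqI) (use w in blast)
qed

lemma poly_eq_0_if_real_roots:
  fixes q :: "complex poly"
  assumes "\<And>r::real. poly q (of_real r) = 0"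
  shows "q = 0"
proof (rule ccontr)
  assume "q \<noteq> 0"
  then have "finite {x. poly q x = 0}" by (rule poly_roots_finite)
  then have "finite (range complex_of_real)" by (rule finite_subset[rotated]) (use assms in auto)
  then have "finite (UNIV :: real set)" by (rule finite_imageD) (simp add: inj_on_def)
  then show False using infinite_UNIV_char_0 by blast
qed

text \<open>Substituting \<open>r ^ w i\<close> for the variable \<open>i\<close>, with weights that
  separate the monomials of \<open>p\<close>, gives a univariate polynomial with the same
  coefficients that vanishes on the real line.\<close>

lemma peval_eq_0_on_reals:
  fixes p :: "'n::finite cpoly"
  assumes "\<And>x::real^'n. peval p (cvec_of_real x) = 0"
  shows "p = 0"
proof -
  obtain w :: "'n \<Rightarrow> nat" where w: "inj_on (\<lambda>m. \<Sum>i\<in>UNIV. w i * lookup m i) (keys p)"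
    using separating_weights[of "keys p"] by auto
  define W where "W m = (\<Sum>i\<in>UNIV. w i * lookup m i)" for m :: "'n \<Rightarrow>\<^sub>0 nat"
  define q where "q = (\<Sum>m\<in>keys p. monom (lookup p m) (W m))"
  have "poly q (of_real r) = 0" for r :: real
  proof -
    have "poly q (of_real r) = peval p (cvec_of_real (\<chi> i. r ^ w i))"
      unfolding q_def peval_def cvec_of_real_def W_def
      by (simp add: poly_sum poly_monom power_sum power_mult)
    then show ?thesis using assms by simp
  qed
  then have q0: "q = 0" by (rule poly_eq_0_if_real_roots)
  have "lookup p m = 0" if "m \<in> keys p" for m
  proof -
    have "coeff q (W m) = (\<Sum>m'\<in>keys p. if m' = m then lookup p m else 0)"
      unfolding q_def coeff_sum using w that
      by (intro sum.cong) (auto simp: W_def inj_on_def)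
    then show ?thesis using q0 that by simp
  qed
  then show ?thesis by (intro poly_mapping_eqI) (metis in_keys_iff lookup_zero)
qed

lemma peval_eqI:
  assumes "\<And>z. peval p z = peval q z"
  shows "p = q"
proof -
  have "p - q = 0" by (rule peval_eq_0_on_reals) (simp add: assms)
  then show ?thesis by simp
qed

lemma real_nonzero_point:
  fixes p :: "'n::finite cpoly"
  assumes "p \<noteq> 0"
  obtains x :: "real^'n" where "peval p (cvec_of_real x) \<noteq> 0"
  using assms peval_eq_0_on_reals by blast

subsection \<open>Univariate polynomials with polynomial coefficients\<close>

text \<open>A polynomial in \<open>t\<close> over the ring of polynomials in \<open>z\<close> is
  specialised at a point \<open>z\<close>; roots, degrees and divisibility are then studied over the
  complex numbers.\<close>

definition ueval :: "'n::finite cpoly poly \<Rightarrow> complex^'n \<Rightarrow> complex poly" where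
  "ueval P z = map_poly (\<lambda>c. peval c z) P"

lemma coeff_ueval [simp]: "coeff (ueval P z) j = peval (coeff P j) z"
  by (simp add: ueval_def coeff_map_poly)

lemma degree_ueval_le: "degree (ueval P z) \<le> degree P"
  by (rule degree_le) (simp add: coeff_eq_0)

lemma poly_ueval: "poly (ueval P z) t = peval (poly P (cconst t)) z"
proof -
  have "poly (ueval P z) t = (\<Sum>i\<le>degree P. peval (coeff P i) z * t ^ i)"
    using poly_as_sum_of_monoms'[OF degree_ueval_le[of P z], THEN arg_cong, of "\<lambda>q. poly q t"]
    by (simp add: poly_sum poly_monom)
  then show ?thesis by (simp add: poly_altdef)
qed

lemma ueval_add [simp]: "ueval (P + Q) z = ueval P z + ueval Q z"
  by (rule poly_eqI) simp

lemma ueval_mult [simp]: "ueval (P * Q) z = ueval P z * ueval Q z"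
  by (subst poly_eq_poly_eq_iff[symmetric]) (simp add: fun_eq_iff poly_ueval)

lemma ueval_smult [simp]: "ueval (smult c P) z = smult (peval c z) (ueval P z)"
  by (rule poly_eqI) simp

lemma ueval_0 [simp]: "ueval 0 z = 0"
  by (rule poly_eqI) simp

lemma ueval_eqI:
  assumes "\<And>z. ueval P z = ueval Q z"
  shows "P = Q"
proof (intro poly_eqI peval_eqI)
  fix n z
  show "peval (coeff P n) z = peval (coeff Q n) z"
    using assms[of z] by (metis coeff_ueval)
qed

section \<open>Polynomials along lines\<close>

definition line_subst :: "'n::finite cpoly \<Rightarrow> ('n \<Rightarrow> 'n cpoly) \<Rightarrow> ('n \<Rightarrow> 'n cpoly) \<Rightarrow> 'n cpoly poly" where
  "line_subst p A B = (\<Sum>m\<in>keys p. smult (cconst (lookup p m)) (\<Prod>i\<in>UNIV. [:A i, B i:] ^ lookup m i))"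

lemma poly_line_subst:
  "poly (ueval (line_subst p A B) z) t = peval p (\<chi> i. peval (A i) z + t * peval (B i) z)"
  by (simp add: poly_ueval line_subst_def poly_sum poly_prod peval_def[of p])

text \<open>Stated with degree bounds, so that it also covers the case in which a formal top
  coefficient vanishes.\<close>

lemma coeff_mult_bounded:
  fixes p q :: "'a::comm_semiring_0 poly"
  assumes "degree p \<le> m" "degree q \<le> n"
  shows "coeff (p * q) (m + n) = coeff p m * coeff q n"
proof -
  have "coeff (p * q) (m + n) = (\<Sum>i\<le>m + n. if i = m then coeff p m * coeff q n else 0)"
    unfolding coeff_mult
  proof (intro sum.cong refl)
    fix i assume "i \<in> {..m + n}"
    show "coeff p i * coeff q (m + n - i) = (if i = m then coeff p m * coeff q n else 0)"
    proof (cases i m rule: linorder_cases)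
      case less
      then have "degree q < m + n - i" using assms by simp
      then show ?thesis using less by (simp add: coeff_eq_0)
    next
      case greater
      then have "degree p < i" using assms by simp
      then show ?thesis using greater by (simp add: coeff_eq_0)
    qed auto
  qed
  then show ?thesis by simp
qed

lemma linear_power_degree_coeff:
  fixes a b :: "'a::comm_semiring_1"
  shows "degree ([:a, b:] ^ n) \<le> n \<and> coeff ([:a, b:] ^ n) n = b ^ n"
proof (induction n)
  case (Suc n)
  have d: "degree [:a, b:] \<le> 1" by simp
  have "degree ([:a, b:] * [:a, b:] ^ n) \<le> 1 + n"
    using Suc d degree_mult_le[of "[:a, b:]" "[:a, b:] ^ n"] by linarith
  moreover have "coeff ([:a, b:] * [:a, b:] ^ n) (1 + n) = b * b ^ n"
    using coeff_mult_bounded[OF d conjunct1[OF Suc]] Suc by simp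
  ultimately show ?case by simp
qed auto

lemma linear_prod_degree_coeff:
  fixes A B :: "'i \<Rightarrow> 'a::comm_semiring_1"
  assumes "finite I"
  shows "degree (\<Prod>i\<in>I. [:A i, B i:] ^ k i) \<le> sum k I \<and>
    coeff (\<Prod>i\<in>I. [:A i, B i:] ^ k i) (sum k I) = (\<Prod>i\<in>I. B i ^ k i)"
  using assms
proof induction
  case (insert j I)
  let ?p = "[:A j, B j:] ^ k j" and ?q = "\<Prod>i\<in>I. [:A i, B i:] ^ k i"
  have p: "degree ?p \<le> k j \<and> coeff ?p (k j) = B j ^ k j" by (rule linear_power_degree_coeff)
  then have "degree (?p * ?q) \<le> k j + sum k I"
    using insert.IH degree_mult_le[of ?p ?q] by linarith
  moreover have "coeff (?p * ?q) (k j + sum k I) = B j ^ k j * (\<Prod>i\<in>I. B i ^ k i)"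
    using coeff_mult_bounded[of ?p "k j" ?q "sum k I"] p insert.IH by simp
  ultimately show ?case using insert.hyps by simp
qed auto

lemma degree_line_subst_le:
  assumes "\<And>m. m \<in> keys p \<Longrightarrow> mono_deg m \<le> D"
  shows "degree (line_subst p A B) \<le> D"
  unfolding line_subst_def
proof (rule degree_sum_le, simp)
  fix m assume "m \<in> keys p"
  then have "degree (\<Prod>i\<in>UNIV. [:A i, B i:] ^ lookup m i) \<le> D"
    using linear_prod_degree_coeff[of UNIV A B "lookup m"] assms[of m] by (auto simp: mono_deg_def)
  then show "degree (smult (cconst (lookup p m)) (\<Prod>i\<in>UNIV. [:A i, B i:] ^ lookup m i)) \<le> D"
    using degree_smult_le order_trans by blast
qed

definition hcomp :: "nat \<Rightarrow> 'n::finite cpoly \<Rightarrow> 'n cpoly" where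
  "hcomp d p = (\<Sum>m\<in>{m \<in> keys p. mono_deg m = d}. single m (lookup p m))"

lemma peval_hcomp:
  "peval (hcomp d p) z = (\<Sum>m\<in>{m \<in> keys p. mono_deg m = d}. lookup p m * (\<Prod>i\<in>UNIV. (z $ i) ^ lookup m i))"
  by (simp add: hcomp_def peval_single)

lemma lookup_hcomp: "lookup (hcomp d p) m = (if mono_deg m = d then lookup p m else 0)"
proof -
  have "lookup (hcomp d p) m = (\<Sum>n\<in>{m \<in> keys p. mono_deg m = d}. if n = m then lookup p m else 0)"
    unfolding hcomp_def lookup_sum by (intro sum.cong) (auto simp: lookup_single)
  then show ?thesis by (simp add: in_keys_iff)
qed

text \<open>A monomial of degree \<open>D\<close> reaches the power \<open>D\<close> of
  \<open>t\<close> only by taking the direction \<open>B\<close> in every factor; monomials of lower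
  degree do not reach it.\<close>

lemma coeff_line_subst:
  assumes "\<And>m. m \<in> keys p \<Longrightarrow> mono_deg m \<le> D"
  shows "peval (coeff (line_subst p A B) D) z = peval (hcomp D p) (\<chi> i. peval (B i) z)"
proof -
  have "peval (coeff (line_subst p A B) D) z = (\<Sum>m\<in>keys p. if mono_deg m = D then
      lookup p m * (\<Prod>i\<in>UNIV. peval (B i) z ^ lookup m i) else 0)"
    unfolding line_subst_def coeff_sum peval_sum
  proof (intro sum.cong refl)
    fix m assume "m \<in> keys p"
    then have le: "mono_deg m \<le> D" by (rule assms)
    note l = linear_prod_degree_coeff[of UNIV A B "lookup m", folded mono_deg_def]
    show "peval (coeff (smult (cconst (lookup p m)) (\<Prod>i\<in>UNIV. [:A i, B i:] ^ lookup m i)) D) z =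
      (if mono_deg m = D then lookup p m * (\<Prod>i\<in>UNIV. peval (B i) z ^ lookup m i) else 0)"
    proof (cases "mono_deg m = D")
      case False
      then have "degree (\<Prod>i\<in>UNIV. [:A i, B i:] ^ lookup m i) < D" using l le by auto
      then show ?thesis using False by (simp add: coeff_eq_0)
    qed (use l in auto)
  qed
  also have "\<dots> = peval (hcomp D p) (\<chi> i. peval (B i) z)"
    by (simp add: peval_hcomp sum.If_cases Int_def)
  finally show ?thesis .
qed

text \<open>\<open>shift w p\<close> is \<open>p(z + t w)\<close>, and \<open>recentre v p\<close> is \<open>p(v + t z)\<close>, as polynomials in \<open>t\<close> over \<open>\<complex>[z]\<close>.\<close>

definition shift :: "complex^'n \<Rightarrow> 'n::finite cpoly \<Rightarrow> 'n cpoly poly" where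
  "shift w p = line_subst p Var (\<lambda>i. cconst (w $ i))"

definition recentre :: "complex^'n \<Rightarrow> 'n::finite cpoly \<Rightarrow> 'n cpoly poly" where
  "recentre v p = line_subst p (\<lambda>i. cconst (v $ i)) Var"

lemma poly_shift [simp]: "poly (ueval (shift w p) z) t = peval p (z + t *s w)"
proof -
  have "(\<chi> i. peval (Var i) z + t * peval (cconst (w $ i)) z) = z + t *s w"
    by (simp add: vec_eq_iff)
  then show ?thesis by (simp add: shift_def poly_line_subst)
qed

lemma poly_recentre [simp]: "poly (ueval (recentre v p) z) t = peval p (v + t *s z)"
proof -
  have "(\<chi> i. peval (cconst (v $ i)) z + t * peval (Var i) z) = v + t *s z"
    by (simp add: vec_eq_iff)
  then show ?thesis by (simp add: recentre_def poly_line_subst)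
qed

text \<open>On the line through a point where \<open>p\<close> is nonzero and one where
  \<open>q\<close> is nonzero, both restrict to nonzero univariate polynomials, whose product is
  nonzero.\<close>

lemma mult_eq_0_cpoly:
  fixes p q :: "'n::finite cpoly"
  assumes "p * q = 0"
  shows "p = 0 \<or> q = 0"
proof (rule ccontr)
  assume "\<not> ?thesis"
  then obtain x y :: "real^'n" where
    x: "peval p (cvec_of_real x) \<noteq> 0" and y: "peval q (cvec_of_real y) \<noteq> 0"
    using real_nonzero_point by metis
  define z w where "z = cvec_of_real x" and "w = cvec_of_real y - z"
  have "ueval (shift w p) z * ueval (shift w q) z = 0"
    by (subst poly_eq_poly_eq_iff[symmetric]) (simp add: fun_eq_iff assms flip: peval_mult)
  then have "ueval (shift w p) z = 0 \<or> ueval (shift w q) z = 0" by simp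
  moreover have "ueval (shift w p) z \<noteq> 0"
    using x poly_shift[of w p z 0] by (auto simp: z_def simp del: poly_shift)
  moreover have "ueval (shift w q) z \<noteq> 0"
    using y poly_shift[of w q z 1] by (auto simp: w_def simp del: poly_shift)
  ultimately show False by simp
qed

subsection \<open>Homogeneous polynomials\<close>

definition homog :: "nat \<Rightarrow> 'n::finite cpoly \<Rightarrow> bool" where
  "homog d p \<longleftrightarrow> (\<forall>m\<in>keys p. mono_deg m = d)"

lemma homogeneous_iff: "homogeneous p \<longleftrightarrow> (\<exists>d. homog d p)"
  by (simp add: homogeneous_def homog_def)

lemma monomial_scale:
  "(\<Prod>i\<in>UNIV. ((c *s z) $ i) ^ lookup m i) = c ^ mono_deg m * (\<Prod>i\<in>UNIV. (z $ i) ^ lookup m i)"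
  by (simp add: power_mult_distrib prod.distrib mono_deg_def power_sum)

lemma peval_scale:
  assumes "homog d p"
  shows "peval p (c *s z) = c ^ d * peval p z"
proof -
  have "peval p (c *s z) = (\<Sum>m\<in>keys p. c ^ d * (lookup p m * (\<Prod>i\<in>UNIV. (z $ i) ^ lookup m i)))"
    unfolding peval_def monomial_scale using assms by (intro sum.cong) (auto simp: homog_def)
  then show ?thesis by (simp add: peval_def sum_distrib_left)
qed

text \<open>Multiplying each coefficient by \<open>2 ^ mono_deg m - 2 ^ d\<close> gives a polynomial
  that vanishes everywhere, so only monomials of degree \<open>d\<close> survive. Thus scaling by 2
  alone detects homogeneity.\<close>

lemma homogI:
  assumes "\<And>z. peval p (2 *s z) = 2 ^ d * peval p z"
  shows "homog d p"
  unfolding homog_def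
proof
  fix m assume m: "m \<in> keys p"
  define q where "q = Poly_Mapping.mapp (\<lambda>m c. c * (2 ^ mono_deg m - 2 ^ d)) p"
  have "peval q z = peval p (2 *s z) - 2 ^ d * peval p z" for z
  proof -
    have "keys q \<subseteq> keys p" unfolding q_def by (rule keys_mapp_subset)
    then have "peval q z = (\<Sum>m\<in>keys p. lookup q m * (\<Prod>i\<in>UNIV. (z $ i) ^ lookup m i))"
      by (simp add: peval_superset)
    also have "\<dots> = (\<Sum>m\<in>keys p. lookup p m * (2 ^ mono_deg m * (\<Prod>i\<in>UNIV. (z $ i) ^ lookup m i))
        - 2 ^ d * (lookup p m * (\<Prod>i\<in>UNIV. (z $ i) ^ lookup m i)))"
      by (intro sum.cong) (auto simp: q_def lookup_mapp algebra_simps)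
    finally show ?thesis
      by (simp add: peval_def[of p] monomial_scale sum_subtractf sum_distrib_left del: vector_smult_component)
  qed
  then have "q = 0" by (intro peval_eqI) (simp add: assms)
  then have "lookup p m * (2 ^ mono_deg m - 2 ^ d) = 0"
    using m lookup_mapp[of "\<lambda>m c. c * (2 ^ mono_deg m - 2 ^ d)" p m] by (simp add: q_def)
  then have "(2::complex) ^ mono_deg m = 2 ^ d" using m by (simp add: in_keys_iff)
  then have "real (2 ^ mono_deg m) = real (2 ^ d)"
    by (metis of_nat_numeral of_nat_power of_nat_eq_iff)
  then have "(2::nat) ^ mono_deg m = 2 ^ d" by (simp only: of_nat_eq_iff)
  then show "mono_deg m = d" by simp
qed

lemma hcomp_homog:
  assumes "homog d p" shows "hcomp d p = p"
  by (rule poly_mapping_eqI) (use assms in \<open>auto simp: lookup_hcomp homog_def in_keys_iff\<close>)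

text \<open>The top coefficient in \<open>t\<close> does not depend on \<open>z\<close>. If
  \<open>p\<close> is nonzero at \<open>w\<close>, then \<open>p\<close> is therefore monic in the
  direction \<open>w\<close> up to a constant, and division by it is possible.\<close>

lemma degree_shift:
  assumes "homog d p"
  shows "degree (shift w p) \<le> d" "coeff (shift w p) d = cconst (peval p w)"
proof -
  show "degree (shift w p) \<le> d"
    unfolding shift_def using assms by (intro degree_line_subst_le) (auto simp: homog_def)
  show "coeff (shift w p) d = cconst (peval p w)"
    unfolding shift_def
    by (rule peval_eqI, subst coeff_line_subst) (use assms in \<open>auto simp: homog_def hcomp_homog vec_lambda_eta\<close>)
qed

lemma coeff_recentre:
  assumes "homog d p"
  shows "degree (recentre v p) \<le> d" "coeff (recentre v p) d = p"
proof -
  show "degree (recentre v p) \<le> d"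
    unfolding recentre_def using assms by (intro degree_line_subst_le) (auto simp: homog_def)
  show "coeff (recentre v p) d = p"
    unfolding recentre_def
    by (rule peval_eqI, subst coeff_line_subst) (use assms in \<open>auto simp: homog_def hcomp_homog vec_lambda_eta\<close>)
qed

lemma mono_deg_eq_0 [simp]: "mono_deg m = 0 \<longleftrightarrow> m = 0"
  by (auto simp: mono_deg_def intro: poly_mapping_eqI)

lemma homog_0_const:
  assumes "homog 0 p" obtains c where "p = cconst c"
proof
  show "p = cconst (lookup p 0)"
    by (rule poly_mapping_eqI)
       (use assms in \<open>auto simp: cconst_def lookup_single homog_def in_keys_iff when_def\<close>)
qed

subsection \<open>Persistence of roots\<close>

text \<open>Every root \<open>c\<close> has distance at least \<open>r\<close> from
  \<open>t0\<close>, so from \<open>t0\<close> to \<open>t\<close> each linear factor grows at most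
  by the factor \<open>1 + dist t t0 / r\<close>.\<close>

lemma poly_growth_no_root:
  fixes p :: "complex poly"
  assumes "r > 0" "\<And>s. dist s t0 < r \<Longrightarrow> poly p s \<noteq> 0" "degree p \<le> D"
  shows "norm (poly p t) \<le> norm (poly p t0) * (1 + dist t t0 / r) ^ D"
  using assms(2,3)
proof (induction D arbitrary: p)
  case 0
  then obtain c where "p = [:c:]" by (auto elim: degree_eq_zeroE)
  then show ?case by simp
next
  case (Suc D)
  let ?b = "1 + dist t t0 / r"
  have b: "1 \<le> ?b" using assms(1) by simp
  show ?case
  proof (cases "degree p = 0")
    case True
    then obtain c where c: "p = [:c:]" by (auto elim: degree_eq_zeroE)
    have "norm c * 1 \<le> norm c * ?b ^ Suc D"
      using one_le_power[OF b, of "Suc D"] by (intro mult_left_mono) auto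
    then show ?thesis by (simp add: c)
  next
    case False
    then have "\<not> constant (poly p)" by (simp add: constant_degree)
    then obtain c where c: "poly p c = 0" using fundamental_theorem_of_algebra by blast
    then obtain q where q: "p = [:- c, 1:] * q" by (auto simp: poly_eq_0_iff_dvd)
    have "q \<noteq> 0" using False q by auto
    then have "degree p = Suc (degree q)" unfolding q by (subst degree_mult_eq) auto
    then have "norm (poly q t) \<le> norm (poly q t0) * ?b ^ D"
      using Suc.prems by (intro Suc.IH) (auto simp: q)
    moreover have "norm (t - c) \<le> norm (t0 - c) * ?b"
    proof -
      have "r \<le> dist c t0" using Suc.prems(1) c by force
      then have "dist t t0 \<le> norm (t0 - c) * (dist t t0 / r)"
        using assms(1) mult_right_mono[of r "dist c t0" "dist t t0"]
        by (simp add: field_simps dist_norm norm_minus_commute)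
      moreover have "norm (t - c) \<le> norm (t0 - c) + dist t t0"
        using norm_triangle_ineq[of "t - t0" "t0 - c"] by (simp add: dist_norm)
      ultimately show ?thesis by (simp add: distrib_left)
    qed
    ultimately have "norm (t - c) * norm (poly q t) \<le> (norm (t0 - c) * ?b) * (norm (poly q t0) * ?b ^ D)"
      using b by (intro mult_mono) auto
    then show ?thesis by (simp add: q norm_mult mult_ac flip: left_diff_distrib)
  qed
qed

text \<open>An elementary form of Hurwitz's theorem. If \<open>p k\<close> had no root near
  \<open>t0\<close>, the growth bound would control its value at \<open>t1\<close> by its value at
  \<open>t0\<close>; in the limit the former stays away from 0 and the latter tends to 0. The degree
  may drop in the limit.\<close>

lemma root_persistence:
  fixes q :: "complex poly"
  assumes conv: "\<And>t. ((\<lambda>k. poly (p k) t) \<longlongrightarrow> poly q t) F"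
    and deg: "\<And>k. degree (p k) \<le> D"
    and q: "poly q t0 = 0" "poly q t1 \<noteq> 0" and r: "r > 0"
  shows "eventually (\<lambda>k. \<exists>t. dist t t0 < r \<and> poly (p k) t = 0) F"
proof -
  let ?B = "(1 + dist t1 t0 / r) ^ D"
  have "((\<lambda>k. norm (poly (p k) t1) - norm (poly (p k) t0) * ?B) \<longlongrightarrow> norm (poly q t1) - norm (poly q t0) * ?B) F"
    by (intro tendsto_intros conv)
  moreover have "norm (poly q t1) - norm (poly q t0) * ?B > 0" using q by simp
  ultimately have "eventually (\<lambda>k. norm (poly (p k) t1) - norm (poly (p k) t0) * ?B > 0) F"
    by (rule order_tendstoD)
  then show ?thesis
  proof eventually_elim
    case (elim k)
    show ?case
    proof (rule ccontr)
      assume "\<not> ?thesis"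
      then have "norm (poly (p k) t1) \<le> norm (poly (p k) t0) * ?B"
        by (intro poly_growth_no_root[OF r _ deg]) auto
      then show False using elim by simp
    qed
  qed
qed

lemma tendsto_vector_smult [tendsto_intros]:
  fixes b :: "'a \<Rightarrow> complex^'n"
  assumes "(a \<longlongrightarrow> a') F" "(b \<longlongrightarrow> b') F"
  shows "((\<lambda>x. a x *s b x) \<longlongrightarrow> a' *s b') F"
proof (rule vec_tendstoI)
  fix i
  have "((\<lambda>x. a x * b x $ i) \<longlongrightarrow> a' * b' $ i) F" using assms by (intro tendsto_intros)
  then show "((\<lambda>x. (a x *s b x) $ i) \<longlongrightarrow> (a' *s b') $ i) F" by simp
qed

lemma mono_deg_bounded:
  obtains D where "\<And>m. m \<in> keys p \<Longrightarrow> mono_deg m \<le> D"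
  by (rule that[of "Max (mono_deg ` keys p)"]) (simp add: Max_ge)

lemma line_root_persistence:
  fixes p :: "'n::finite cpoly"
  assumes "(z \<longlongrightarrow> z0) F" "(w \<longlongrightarrow> w0) F"
    and "peval p (z0 + t0 *s w0) = 0" "peval p (z0 + t1 *s w0) \<noteq> 0" "r > 0"
  shows "eventually (\<lambda>k. \<exists>t. dist t t0 < r \<and> peval p (z k + t *s w k) = 0) F"
proof -
  obtain D where D: "\<And>m. m \<in> keys p \<Longrightarrow> mono_deg m \<le> D" using mono_deg_bounded by blast
  have "eventually (\<lambda>k. \<exists>t. dist t t0 < r \<and> poly (ueval (shift (w k) p) (z k)) t = 0) F"
  proof (rule root_persistence)
    show "((\<lambda>k. poly (ueval (shift (w k) p) (z k)) t) \<longlongrightarrow> poly (ueval (shift w0 p) z0) t) F" for t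
      unfolding poly_shift by (intro tendsto_intros assms)
    show "degree (ueval (shift (w k) p) (z k)) \<le> D" for k
      using degree_ueval_le degree_line_subst_le[OF D] unfolding shift_def by (meson order_trans)
  qed (use assms in auto)
  then show ?thesis by simp
qed

lemma poly_has_root:
  fixes p :: "complex poly"
  assumes "coeff p d \<noteq> 0" "d \<ge> 1"
  obtains t where "poly p t = 0"
proof -
  have "degree p \<noteq> 0" using le_degree[OF assms(1)] assms(2) by simp
  then have "\<not> constant (poly p)" by (simp add: constant_degree)
  then show ?thesis using fundamental_theorem_of_algebra that by blast
qed

subsection \<open>Imaginary projections\<close>

lemma cvec_of_real_nth [simp]: "cvec_of_real x $ i = of_real (x $ i)"
  by (simp add: cvec_of_real_def)

lemma Im_vec_nth [simp]: "Im_vec z $ i = Im (z $ i)"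
  by (simp add: Im_vec_def)

lemma cvec_of_real_add [simp]: "cvec_of_real (x + y) = cvec_of_real x + cvec_of_real y"
  by (simp add: vec_eq_iff)

lemma cvec_of_real_scaleR [simp]: "cvec_of_real (c *\<^sub>R x) = of_real c *s cvec_of_real x"
  by (simp add: vec_eq_iff)

lemma cvec_of_real_0 [simp]: "cvec_of_real 0 = 0"
  by (simp add: vec_eq_iff)

lemma tendsto_cvec_of_real [tendsto_intros]:
  assumes "(g \<longlongrightarrow> x) F" shows "((\<lambda>k. cvec_of_real (g k)) \<longlongrightarrow> cvec_of_real x) F"
  unfolding cvec_of_real_def using assms by (intro tendsto_intros)

lemma tendsto_Im_vec [tendsto_intros]:
  assumes "(g \<longlongrightarrow> z) F" shows "((\<lambda>k. Im_vec (g k)) \<longlongrightarrow> Im_vec z) F"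
  unfolding Im_vec_def using assms by (intro tendsto_intros)

lemma cvec_Re_Im: "z = cvec_of_real (\<chi> i. Re (z $ i)) + \<i> *s cvec_of_real (Im_vec z)"
  by (simp add: vec_eq_iff complex_eq)

lemma in_imag_proj_iff:
  "y \<in> imag_proj f \<longleftrightarrow> (\<exists>x. peval f (cvec_of_real x + \<i> *s cvec_of_real y) = 0)"
proof
  assume "y \<in> imag_proj f"
  then obtain z where "peval f z = 0" "y = Im_vec z" by (auto simp: imag_proj_def zero_set_def)
  then show "\<exists>x. peval f (cvec_of_real x + \<i> *s cvec_of_real y) = 0"
    using cvec_Re_Im[of z] by metis
next
  assume "\<exists>x. peval f (cvec_of_real x + \<i> *s cvec_of_real y) = 0"
  then obtain x where "peval f (cvec_of_real x + \<i> *s cvec_of_real y) = 0" by blast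
  moreover have "Im_vec (cvec_of_real x + \<i> *s cvec_of_real y) = y" by (simp add: vec_eq_iff)
  ultimately show "y \<in> imag_proj f" by (force simp: imag_proj_def zero_set_def)
qed

lemma imag_projI: "peval f z = 0 \<Longrightarrow> Im_vec z \<in> imag_proj f"
  by (simp add: imag_proj_def zero_set_def)

lemma imag_proj_scale:
  assumes f: "homog d f" and y: "c *\<^sub>R y \<in> imag_proj f" and c: "c \<noteq> 0"
  shows "y \<in> imag_proj f"
proof -
  obtain z where z: "peval f z = 0" "Im_vec z = c *\<^sub>R y"
    using y by (auto simp: imag_proj_def zero_set_def)
  have "Im_vec (of_real (inverse c) *s z) = y"
  proof -
    have "Im (z $ i) = c * y $ i" for i using arg_cong[OF z(2), of "\<lambda>v. v $ i"] by simp
    then show ?thesis using c by (simp add: vec_eq_iff flip: of_real_inverse)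
  qed
  then show ?thesis using imag_projI[of f "of_real (inverse c) *s z"] z(1) peval_scale[OF f] by simp
qed

text \<open>Used mostly in contraposition: along a direction outside the imaginary projection, a
  real line has only real roots.\<close>

lemma imag_proj_line:
  assumes "homog d f" "peval f (cvec_of_real x + t *s cvec_of_real y) = 0" "Im t \<noteq> 0"
  shows "y \<in> imag_proj f"
proof (rule imag_proj_scale[OF assms(1) _ assms(3)])
  have "Im_vec (cvec_of_real x + t *s cvec_of_real y) = Im t *\<^sub>R y" by (simp add: vec_eq_iff)
  then show "Im t *\<^sub>R y \<in> imag_proj f" using imag_projI[OF assms(2)] by simp
qed

text \<open>By homogeneity, \<i> times a real zero is again a zero.\<close>

lemma real_zero_set_subset_imag_proj:
  assumes "homog d f" shows "real_zero_set f \<subseteq> imag_proj f"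
proof
  fix x assume "x \<in> real_zero_set f"
  then have "peval f (cvec_of_real 0 + \<i> *s cvec_of_real x) = 0"
    using peval_scale[OF assms, of \<i>] by (simp add: real_zero_set_def)
  then show "x \<in> imag_proj f" unfolding in_imag_proj_iff by blast
qed

lemma real_zero_set_scale:
  assumes "homog d f" "c *\<^sub>R y \<in> real_zero_set f" "c \<noteq> 0"
  shows "y \<in> real_zero_set f"
  using assms peval_scale[OF assms(1), of "of_real c" "cvec_of_real y"] by (simp add: real_zero_set_def)

subsection \<open>Products of real linear polynomials\<close>

text \<open>On the line \<open>x + t y\<close> the polynomial is \<open>a + b t\<close> with
  \<open>a\<close> and \<open>b\<close> real, and \<open>a + \<i> b = 0\<close> forces
  \<open>a = 0\<close>.\<close>

lemma real_linear_poly_real_part: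
  assumes l: "real_linear_poly l" and 0: "peval l (cvec_of_real x + \<i> *s cvec_of_real y) = 0"
  shows "peval l (cvec_of_real x) = 0"
proof -
  have re: "peval l (cvec_of_real u) \<in> \<real>" for u
    unfolding peval_def using l
    by (intro sum_in_Reals Reals_mult prod_in_Reals Reals_power) (auto simp: real_linear_poly_def)
  define q where "q = ueval (shift (cvec_of_real y) l) (cvec_of_real x)"
  have "degree q \<le> 1"
    using degree_ueval_le[of "shift (cvec_of_real y) l" "cvec_of_real x"] l
      degree_line_subst_le[of l 1 Var "\<lambda>i. cconst (cvec_of_real y $ i)"]
    unfolding q_def shift_def real_linear_poly_def by (meson order_trans)
  then have "q = [:coeff q 0, coeff q 1:]"
    by (intro poly_eqI) (auto simp: coeff_pCons coeff_eq_0 split: nat.split)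
  then obtain a b where ab: "q = [:a, b:]" by blast
  have q: "poly q t = peval l (cvec_of_real x + t *s cvec_of_real y)" for t by (simp add: q_def)
  have a: "a \<in> \<real>" using q[of 0] re[of x] by (simp add: ab)
  have "a + b \<in> \<real>" using q[of 1] re[of "x + y"] by (simp add: ab)
  then have "b \<in> \<real>" using a Reals_diff[of "a + b" a] by simp
  moreover have "a + \<i> * b = 0" using q[of \<i>] 0 by (simp add: ab)
  ultimately have "a = 0" using a by (auto simp: complex_eq_iff elim!: Reals_cases)
  then show ?thesis using q[of 0] by (simp add: ab)
qed

lemma imag_proj_prod_real_linear:
  assumes f: "homog d f" and ls: "\<And>l. l \<in> set ls \<Longrightarrow> real_linear_poly l"
    and eq: "cconst c * f = prod_list ls" and c: "c \<noteq> 0"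
  shows "imag_proj f \<subseteq> real_zero_set f"
proof
  fix y assume "y \<in> imag_proj f"
  then obtain x where x: "peval f (cvec_of_real x + \<i> *s cvec_of_real y) = 0"
    unfolding in_imag_proj_iff by blast
  \<comment> \<open>Multiplication by \<open>- \<i>\<close> turns the imaginary part
    \<open>y\<close> of a zero into the real part of another zero.\<close>
  have z: "cvec_of_real y + \<i> *s cvec_of_real (- x) = (- \<i>) *s (cvec_of_real x + \<i> *s cvec_of_real y)"
    by (simp add: vec_eq_iff algebra_simps)
  have root: "peval f z = 0 \<longleftrightarrow> (\<exists>l\<in>set ls. peval l z = 0)" for z
  proof -
    have "c * peval f z = (\<Prod>l\<leftarrow>ls. peval l z)"
      using arg_cong[OF eq, of "\<lambda>p. peval p z"] by simp
    moreover have "(\<Prod>l\<leftarrow>ls. peval l z) = 0 \<longleftrightarrow> (\<exists>l\<in>set ls. peval l z = 0)"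
      by (induction ls) auto
    ultimately show ?thesis using c by auto
  qed
  have "peval f (cvec_of_real y + \<i> *s cvec_of_real (- x)) = 0"
    unfolding z peval_scale[OF f] using x by simp
  then obtain l where "l \<in> set ls" "peval l (cvec_of_real y + \<i> *s cvec_of_real (- x)) = 0"
    unfolding root by blast
  then have "peval l (cvec_of_real y) = 0" using real_linear_poly_real_part ls by blast
  then show "y \<in> real_zero_set f"
    using \<open>l \<in> set ls\<close> root by (auto simp: real_zero_set_def)
qed

subsection \<open>Splitting off real linear factors\<close>

text \<open>Doubling \<open>z\<close> has the same effect as doubling \<open>t\<close>, which
  multiplies the coefficient of \<open>t ^ j\<close> by \<open>2 ^ j\<close>.\<close>

lemma homog_coeff_recentre:
  "homog j (coeff (recentre v g) j)"
proof (rule homogI)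
  fix z
  have "ueval (recentre v g) (2 *s z) = pcompose (ueval (recentre v g) z) [:0, 2:]"
    by (subst poly_eq_poly_eq_iff[symmetric])
       (simp add: fun_eq_iff poly_pcompose vector_smult_assoc mult.commute)
  then have "coeff (ueval (recentre v g) (2 *s z)) j = 2 ^ j * coeff (ueval (recentre v g) z) j"
    by (simp add: coeff_pcompose_linear)
  then show "peval (coeff (recentre v g) j) (2 *s z) = 2 ^ j * peval (coeff (recentre v g) j) z"
    by simp
qed

lemma tendsto_lowest_coeff:
  fixes S :: "complex poly"
  assumes "\<And>j. j < m \<Longrightarrow> coeff S j = 0"
  shows "((\<lambda>\<epsilon>::real. poly S (of_real \<epsilon>) / of_real \<epsilon> ^ m) \<longlongrightarrow> coeff S m) (at_right 0)"
proof -
  have "monom 1 m dvd S" using assms by (simp add: monom_1_dvd_iff')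
  then obtain T where T: "S = monom 1 m * T" by (rule dvdE)
  have "((\<lambda>\<epsilon>::real. poly T (of_real \<epsilon>)) \<longlongrightarrow> poly T (of_real 0)) (at_right 0)"
    by (intro tendsto_intros)
  then have "((\<lambda>\<epsilon>::real. poly T (of_real \<epsilon>)) \<longlongrightarrow> coeff S m) (at_right 0)"
    by (simp add: T coeff_monom_mult poly_0_coeff_0)
  moreover have "eventually (\<lambda>\<epsilon>::real. poly T (of_real \<epsilon>) = poly S (of_real \<epsilon>) / of_real \<epsilon> ^ m) (at_right 0)"
    unfolding eventually_at_filter by (simp add: T poly_monom)
  ultimately show ?thesis by (rule Lim_transform_eventually)
qed

text \<open>The lowest-order term at \<open>v\<close> is the limit of
  \<open>g(v + \<epsilon> z) / \<epsilon> ^ m\<close>, so near each of its zeros \<open>z\<close>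
  there are points \<open>w\<close> with \<open>g(v + \<epsilon> w) = 0\<close>. As \<open>v\<close>
  is real, the imaginary part of this zero of \<open>g\<close> is \<epsilon> times that of
  \<open>w\<close>, and the factor \<epsilon> is removed by homogeneity of \<open>h\<close>.\<close>

lemma imag_proj_lowest_term:
  fixes g h :: "'n::finite cpoly"
  defines "g' \<equiv> \<lambda>v m. coeff (recentre (cvec_of_real v) g) m"
  assumes g: "homog d g" and h: "homog k h" and sub: "imag_proj g \<subseteq> real_zero_set h"
    and low: "\<And>j. j < m \<Longrightarrow> g' v j = 0" and nz: "g' v m \<noteq> 0"
  shows "imag_proj (g' v m) \<subseteq> real_zero_set h"
proof
  fix y assume "y \<in> imag_proj (g' v m)"
  then obtain z where z: "peval (g' v m) z = 0" "y = Im_vec z"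
    by (auto simp: imag_proj_def zero_set_def)
  obtain u where u: "peval (g' v m) u \<noteq> 0" using nz real_nonzero_point by blast
  \<comment> \<open>The line from \<open>z\<close> towards \<open>u\<close> keeps the limit
    polynomial nonzero: at \<open>t = 1\<close> its value is that at \<open>u\<close>.\<close>
  define e where "e = u - z"
  let ?v = "cvec_of_real v"
  show "y \<in> real_zero_set h"
  proof (rule ccontr)
    assume y: "y \<notin> real_zero_set h"
    have "((\<lambda>t. peval h (cvec_of_real (Im_vec (z + t *s e)))) \<longlongrightarrow>
        peval h (cvec_of_real (Im_vec (z + 0 *s e)))) (nhds 0)"
      by (intro tendsto_intros filterlim_ident)
    moreover have "peval h (cvec_of_real (Im_vec (z + 0 *s e))) \<noteq> 0"
      using y z by (simp add: real_zero_set_def)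
    ultimately have "eventually (\<lambda>t. peval h (cvec_of_real (Im_vec (z + t *s e))) \<noteq> 0) (nhds 0)"
      by (rule tendsto_imp_eventually_ne)
    then obtain r where r: "r > 0" "\<And>t. dist t 0 < r \<Longrightarrow> peval h (cvec_of_real (Im_vec (z + t *s e))) \<noteq> 0"
      unfolding eventually_nhds_metric by blast
    define p where "p \<epsilon> = smult (1 / of_real \<epsilon> ^ m) (ueval (shift (of_real \<epsilon> *s e) g) (?v + of_real \<epsilon> *s z))"
      for \<epsilon> :: real
    have p: "poly (p \<epsilon>) t = poly (ueval (recentre ?v g) (z + t *s e)) (of_real \<epsilon>) / of_real \<epsilon> ^ m" for \<epsilon> t
      by (simp add: p_def vector_smult_assoc mult.commute add.assoc vector_add_ldistrib)
    have "eventually (\<lambda>\<epsilon>. \<exists>t. dist t 0 < r \<and> poly (p \<epsilon>) t = 0) (at_right 0)"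
    proof (rule root_persistence)
      show "((\<lambda>\<epsilon>. poly (p \<epsilon>) t) \<longlongrightarrow> poly (ueval (shift e (g' v m)) z) t) (at_right 0)" for t
        unfolding p
        using tendsto_lowest_coeff[of m "ueval (recentre ?v g) (z + t *s e)"] low
        by (simp add: g'_def)
      show "degree (p \<epsilon>) \<le> d" for \<epsilon>
        unfolding p_def using degree_smult_le degree_ueval_le degree_shift(1)[OF g] by (meson order_trans)
      show "poly (ueval (shift e (g' v m)) z) 0 = 0" using z by simp
      show "poly (ueval (shift e (g' v m)) z) 1 \<noteq> 0" using u by (simp add: e_def)
    qed (rule r)
    moreover have "eventually (\<lambda>\<epsilon>::real. \<epsilon> > 0) (at_right 0)"
      by (simp add: eventually_at_right_less)
    ultimately have "eventually (\<lambda>\<epsilon>. \<epsilon> > 0 \<and> (\<exists>t. dist t 0 < r \<and> poly (p \<epsilon>) t = 0)) (at_right 0)"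
      by eventually_elim auto
    then obtain \<epsilon> t where \<epsilon>: "\<epsilon> > 0" "dist t 0 < r" "poly (p \<epsilon>) t = 0"
      using eventually_happens'[OF trivial_limit_at_right_real] by blast
    then have "peval g (?v + of_real \<epsilon> *s (z + t *s e)) = 0" by (simp add: p)
    moreover have "Im_vec (?v + of_real \<epsilon> *s (z + t *s e)) = \<epsilon> *\<^sub>R Im_vec (z + t *s e)"
      by (simp add: vec_eq_iff algebra_simps)
    ultimately have "\<epsilon> *\<^sub>R Im_vec (z + t *s e) \<in> real_zero_set h"
      using imag_projI sub by (metis subsetD)
    then have "Im_vec (z + t *s e) \<in> real_zero_set h"
      using real_zero_set_scale[OF h] \<epsilon> by simp
    then show False using r \<epsilon> by (simp add: real_zero_set_def)
  qed
qed

text \<open>A homogeneous \<open>g\<close> of least positive degree with \<open>imag_proj g \<subseteq> real_zero_set f\<close> agrees with its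
  lowest-order term at each of its real zeros \<open>v\<close>, i.e. is invariant under translation by \<open>v\<close>. Hence
  its real zero set is a linear subspace, and it meets every line in a direction \<open>e\<close> with \<open>f(e) \<noteq> 0\<close>.\<close>

lemma hyperplane_in_real_zero_set:
  fixes f :: "'n::finite cpoly"
  assumes f: "f \<noteq> 0" "homog d f" "d \<ge> 1" and sub: "imag_proj f \<subseteq> real_zero_set f"
  obtains a e :: "real^'n" where "a \<bullet> e \<noteq> 0" "\<And>x. a \<bullet> x = 0 \<Longrightarrow> peval f (cvec_of_real x) = 0"
proof -
  define P where "P m \<longleftrightarrow> m \<ge> 1 \<and> (\<exists>g::'n cpoly. g \<noteq> 0 \<and> homog m g \<and> imag_proj g \<subseteq> real_zero_set f)" for m
  define m where "m = (LEAST m. P m)"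
  have "P d" using assms unfolding P_def by blast
  then have "P m" unfolding m_def by (rule LeastI)
  then obtain g :: "'n cpoly" where m: "m \<ge> 1" and g: "g \<noteq> 0" "homog m g" "imag_proj g \<subseteq> real_zero_set f"
    unfolding P_def by blast
  have least: "m \<le> j" if "P j" for j unfolding m_def using that by (rule Least_le)
  define L where "L = real_zero_set g"
  have L: "x \<in> L \<longleftrightarrow> peval g (cvec_of_real x) = 0" for x by (simp add: L_def real_zero_set_def)
  have Lf: "x \<in> L \<Longrightarrow> peval f (cvec_of_real x) = 0" for x
    using real_zero_set_subset_imag_proj[OF g(2)] g(3) by (auto simp: L_def real_zero_set_def)
  have inv: "v + u \<in> L" if v: "v \<in> L" and u: "u \<in> L" for v u
  proof -
    let ?T = "recentre (cvec_of_real v) g"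
    have "coeff ?T j = 0" if "j < m" for j
    proof -
      \<comment> \<open>\<open>m'\<close> is the order of vanishing of \<open>g\<close> at
        \<open>v\<close>. The lowest-order term competes with \<open>g\<close> in the choice of
        \<open>m\<close>, which gives \<open>m \<le> m'\<close>.\<close>
      define m' where "m' = (LEAST j. coeff ?T j \<noteq> 0)"
      have Tm: "coeff ?T m \<noteq> 0" using coeff_recentre(2)[OF g(2)] g(1) by simp
      have m': "coeff ?T m' \<noteq> 0" unfolding m'_def by (rule LeastI, rule Tm)
      have low: "coeff ?T j = 0" if "j < m'" for j
        using not_less_Least that unfolding m'_def by blast
      have "coeff ?T 0 = 0"
      proof (rule peval_eqI)
        fix z show "peval (coeff ?T 0) z = peval 0 z"
          using poly_recentre[of "cvec_of_real v" g z 0] v by (simp add: poly_0_coeff_0 L del: poly_recentre)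
      qed
      then have "m' \<ge> 1" using m' by (cases m') auto
      moreover have "imag_proj (coeff ?T m') \<subseteq> real_zero_set f"
        by (rule imag_proj_lowest_term[OF g(2) f(2) g(3) low m'])
      ultimately have "P m'" unfolding P_def using m' homog_coeff_recentre by blast
      then have "m \<le> m'" by (rule least)
      then show ?thesis using low that by simp
    qed
    moreover have "coeff ?T j = 0" if "j > m" for j
      using coeff_recentre(1)[OF g(2), of "cvec_of_real v"] that by (intro coeff_eq_0) simp
    ultimately have "coeff ?T j = (if j = m then g else 0)" for j
      using coeff_recentre(2)[OF g(2)] by (cases j m rule: linorder_cases) auto
    then have "ueval ?T (cvec_of_real u) = monom (peval g (cvec_of_real u)) m"
      by (intro poly_eqI) simp
    then have "poly (ueval ?T (cvec_of_real u)) 1 = peval g (cvec_of_real u)"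
      by (simp add: poly_monom)
    then show ?thesis using u by (simp add: L)
  qed
  have Lscale: "c *\<^sub>R x \<in> L" if "x \<in> L" for c x
    using that peval_scale[OF g(2)] by (simp add: L)
  obtain e where e: "peval f (cvec_of_real e) \<noteq> 0" using f(1) by (rule real_nonzero_point)
  then have eL: "e \<notin> L" using Lf by blast
  \<comment> \<open>The restriction of \<open>g\<close> to the line has degree
    \<open>m \<ge> 1\<close>, hence a root; a nonreal root would put \<open>e\<close> into
    \<open>imag_proj g\<close>, where \<open>f\<close> vanishes.\<close>
  have ex: "\<exists>t. x + t *\<^sub>R e \<in> L" for x
  proof -
    let ?q = "ueval (shift (cvec_of_real e) g) (cvec_of_real x)"
    have "coeff ?q m \<noteq> 0" using degree_shift(2)[OF g(2)] eL by (simp add: L)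
    then obtain t where "poly ?q t = 0" using m by (rule poly_has_root)
    then have t: "peval g (cvec_of_real x + t *s cvec_of_real e) = 0" by simp
    have "Im t = 0"
    proof (rule ccontr)
      assume "Im t \<noteq> 0"
      then have "e \<in> imag_proj g" by (rule imag_proj_line[OF g(2) t])
      then show False using g(3) e by (auto simp: real_zero_set_def)
    qed
    then have "t = of_real (Re t)" by (simp add: complex_eq_iff)
    then have "x + Re t *\<^sub>R e \<in> L" using t by (simp add: L)
    then show ?thesis by blast
  qed
  have unique: "t = t'" if "x + t *\<^sub>R e \<in> L" "x + t' *\<^sub>R e \<in> L" for x t t'
  proof (rule ccontr)
    assume "t \<noteq> t'"
    have "(x + t *\<^sub>R e) + (-1) *\<^sub>R (x + t' *\<^sub>R e) \<in> L" using inv Lscale that by blast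
    moreover have "(x + t *\<^sub>R e) + (-1) *\<^sub>R (x + t' *\<^sub>R e) = (t - t') *\<^sub>R e"
      by (simp add: algebra_simps)
    ultimately have "inverse (t - t') *\<^sub>R ((t - t') *\<^sub>R e) \<in> L" using Lscale by metis
    then show False using \<open>t \<noteq> t'\<close> eL by simp
  qed
  \<comment> \<open>\<open>\<tau> x\<close> is the unique parameter at which the line through
    \<open>x\<close> in direction \<open>e\<close> meets \<open>L\<close>. It is a linear functional
    with kernel \<open>L\<close>, represented below by the vector
    \<open>adjoint \<tau> 1\<close>.\<close>
  define \<tau> where "\<tau> x = (SOME t. x + t *\<^sub>R e \<in> L)" for x
  have \<tau>: "x + \<tau> x *\<^sub>R e \<in> L" for x unfolding \<tau>_def using ex by (rule someI_ex)
  have "linear \<tau>"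
  proof (rule linearI)
    fix x y c
    have "(x + \<tau> x *\<^sub>R e) + (y + \<tau> y *\<^sub>R e) \<in> L" using inv \<tau> by blast
    then have "(x + y) + (\<tau> x + \<tau> y) *\<^sub>R e \<in> L" by (simp add: algebra_simps)
    then show "\<tau> (x + y) = \<tau> x + \<tau> y" using unique \<tau> by blast
    have "c *\<^sub>R (x + \<tau> x *\<^sub>R e) \<in> L" using Lscale \<tau> by blast
    then have "c *\<^sub>R x + (c * \<tau> x) *\<^sub>R e \<in> L" by (simp add: algebra_simps)
    then show "\<tau> (c *\<^sub>R x) = c *\<^sub>R \<tau> x" using unique \<tau> by auto
  qed
  then have a: "adjoint \<tau> 1 \<bullet> x = \<tau> x" for x
    using adjoint_works[of \<tau> x 1] by (simp add: inner_commute)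
  show ?thesis
  proof (rule that[of "adjoint \<tau> 1" e])
    have "0 \<in> L" using Lscale[OF \<tau>, of 0 0] by simp
    then have "e + (-1) *\<^sub>R e \<in> L" by simp
    then have "\<tau> e = -1" using unique \<tau> by blast
    then show "adjoint \<tau> 1 \<bullet> e \<noteq> 0" by (simp add: a)
    show "peval f (cvec_of_real x) = 0" if "adjoint \<tau> 1 \<bullet> x = 0" for x
      using that \<tau>[of x] Lf by (simp add: a)
  qed
qed

section \<open>Division with constant leading coefficient\<close>

lemma cconst_mult: "cconst a * cconst b = cconst (a * b)"
  by (rule peval_eqI) simp

lemma cconst_1 [simp]: "cconst 1 = 1"
  by (rule peval_eqI) simp

lemma cconst_power: "cconst a ^ n = cconst (a ^ n)"
  by (rule peval_eqI) simp

text \<open>Pseudo-division multiplies \<open>P\<close> by a power of the leading coefficient of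
  \<open>D\<close>, which is here an invertible constant.\<close>

lemma division_unit_lead:
  fixes P D :: "'n::finite cpoly poly"
  assumes "lead_coeff D = cconst c" "c \<noteq> 0"
  obtains q r where "P = D * q + r" "r = 0 \<or> degree r < degree D"
proof -
  have "D \<noteq> 0"
  proof
    assume "D = 0"
    then have "peval (cconst c) (0 :: complex^'n) = 0" using assms(1) by simp
    then show False using assms(2) by simp
  qed
  obtain q r where qr: "pseudo_divmod P D = (q, r)" by (cases "pseudo_divmod P D")
  define N where "N = Suc (degree P) - degree D"
  note * = pseudo_divmod[OF \<open>D \<noteq> 0\<close> qr, folded N_def]
  have inv: "cconst (inverse (c ^ N)) * cconst (c ^ N) = 1" using assms(2) by (simp add: cconst_mult)
  have "smult (cconst (c ^ N)) P = D * q + r"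
    using *(1) assms(1) by (simp add: cconst_power)
  then have "smult (cconst (inverse (c ^ N))) (smult (cconst (c ^ N)) P) =
      smult (cconst (inverse (c ^ N))) (D * q + r)" by simp
  then have "P = D * smult (cconst (inverse (c ^ N))) q + smult (cconst (inverse (c ^ N))) r"
    by (simp add: inv smult_add_right)
  moreover have "smult (cconst (inverse (c ^ N))) r = 0 \<or> degree (smult (cconst (inverse (c ^ N))) r) < degree D"
    using *(2) degree_smult_le[of "cconst (inverse (c ^ N))" r] by auto
  ultimately show ?thesis by (rule that)
qed

section \<open>Real linear forms as factors\<close>

definition lform :: "real^'n \<Rightarrow> 'n::finite cpoly" where
  "lform a = (\<Sum>i\<in>UNIV. single (single i 1) (of_real (a $ i)))"

lemma peval_lform: "peval (lform a) z = (\<Sum>i\<in>UNIV. of_real (a $ i) * z $ i)"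
proof -
  have "single (single i 1) (of_real (a $ i)) = cconst (of_real (a $ i)) * Var i" for i
    by (simp add: cconst_def Var_def mult_single)
  then show ?thesis by (simp add: lform_def)
qed

lemma peval_lform_real: "peval (lform a) (cvec_of_real x) = of_real (a \<bullet> x)"
  by (simp add: peval_lform inner_vec_def)

lemma peval_lform_scale: "peval (lform a) (c *s z) = c * peval (lform a) z"
  by (simp add: peval_lform sum_distrib_left mult_ac)

lemma real_linear_poly_lform: "real_linear_poly (lform a)"
proof -
  have "mono_deg m \<le> 1" if "m \<in> keys (lform a)" for m
  proof -
    have "keys (lform a) \<subseteq> (\<Union>i. keys (single (single i (1::nat)) (complex_of_real (a $ i))))"
      unfolding lform_def by (rule Poly_Mapping.keys_sum)
    then have "m \<in> (\<Union>i. keys (single (single i (1::nat)) (complex_of_real (a $ i))))" using that by blast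
    then obtain i where i: "m = single i 1" by (auto split: if_splits)
    have "mono_deg m = (\<Sum>j\<in>UNIV. if j = i then 1 else 0)"
      unfolding mono_deg_def i by (intro sum.cong) (auto simp: lookup_single)
    then show ?thesis by simp
  qed
  moreover have "lookup (lform a) m \<in> \<real>" for m
    unfolding lform_def lookup_sum by (intro sum_in_Reals) (simp add: lookup_single when_def)
  ultimately show ?thesis by (simp add: real_linear_poly_def)
qed

text \<open>Along \<open>e\<close> the linear form is affine in \<open>t\<close> with constant slope
  \<open>a \<bullet> e\<close>, so \<open>f(z + t e)\<close> can be divided by it. The remainder is
  free of \<open>t\<close>, and is evaluated at the points where real lines meet the
  hyperplane.\<close>

lemma linear_factor:
  fixes f :: "'n::finite cpoly"
  assumes ae: "a \<bullet> e \<noteq> 0" and van: "\<And>x. a \<bullet> x = 0 \<Longrightarrow> peval f (cvec_of_real x) = 0"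
  obtains g where "f = lform a * g"
proof -
  let ?e = "cvec_of_real e"
  define D where "D = [:lform a, cconst (of_real (a \<bullet> e)) :: 'n cpoly:]"
  have "cconst (of_real (a \<bullet> e)) \<noteq> (0 :: 'n cpoly)"
    using ae peval_cconst[of "of_real (a \<bullet> e)" "0 :: complex^'n"] by (metis of_real_eq_0_iff peval_0)
  then have D: "degree D = 1" "lead_coeff D = cconst (of_real (a \<bullet> e))" by (simp_all add: D_def)
  obtain q r where qr: "shift ?e f = D * q + r" "r = 0 \<or> degree r < degree D"
    using division_unit_lead[OF D(2)] ae by (metis of_real_eq_0_iff)
  have "degree r = 0" using qr(2) D(1) by auto
  then obtain r0 where r0: "r = [:r0:]" by (rule degree_eq_zeroE)
  have ev: "peval f (z + t *s ?e) = (peval (lform a) z + t * of_real (a \<bullet> e)) * poly (ueval q z) t + peval r0 z" for z t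
  proof -
    have "poly (ueval D z) t = peval (lform a) z + t * of_real (a \<bullet> e)" "poly (ueval r z) t = peval r0 z"
      unfolding poly_ueval by (simp_all add: D_def r0)
    then show ?thesis using arg_cong[OF qr(1), of "\<lambda>P. poly (ueval P z) t"] by simp
  qed
  have "r0 = 0"
  proof (rule peval_eq_0_on_reals)
    fix x :: "real^'n"
    \<comment> \<open>The parameter at which the line through \<open>x\<close> in direction
      \<open>e\<close> meets the hyperplane.\<close>
    define t where "t = - (a \<bullet> x) / (a \<bullet> e)"
    have "a \<bullet> (x + t *\<^sub>R e) = 0" using ae by (simp add: t_def inner_add_right inner_diff_right)
    then have "peval f (cvec_of_real (x + t *\<^sub>R e)) = 0" by (rule van)
    moreover have "of_real (a \<bullet> x) + complex_of_real t * of_real (a \<bullet> e) = 0"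
      using ae by (simp add: t_def)
    ultimately show "peval r0 (cvec_of_real x) = 0"
      using ev[of "cvec_of_real x" "of_real t"] by (simp add: peval_lform_real)
  qed
  then have "f = lform a * poly q (cconst 0)"
    using ev[of _ 0] by (intro peval_eqI) (simp add: poly_ueval)
  then show ?thesis by (rule that)
qed

text \<open>Homogeneity follows by cancelling \<open>lform a\<close> in the scaling identity. If a
  zero of \<open>g\<close> had an imaginary part \<open>y\<close> outside the zeros of
  \<open>g\<close>, then \<open>y\<close> would lie on the hyperplane; a nearby zero of
  \<open>g\<close> has its imaginary part off the hyperplane and still outside the zeros of
  \<open>g\<close>, where neither factor vanishes.\<close>

lemma linear_cofactor:
  fixes g :: "'n::finite cpoly"
  assumes f: "homog d (lform a * g)" "d \<ge> 1" "imag_proj (lform a * g) \<subseteq> real_zero_set (lform a * g)"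
    and ae: "a \<bullet> e \<noteq> 0"
  shows "homog (d - 1) g" "imag_proj g \<subseteq> real_zero_set g"
proof -
  have l0: "lform a \<noteq> 0"
    using peval_lform_real[of a e] ae by (metis of_real_eq_0_iff peval_0)
  define G where "G = poly (recentre 0 g) (cconst 2)"
  have G: "peval G z = peval g (2 *s z)" for z
    using poly_recentre[of 0 g z 2] by (simp add: G_def poly_ueval)
  have "lform a * (cconst 2 * G - cconst (2 ^ d) * g) = 0"
  proof (rule peval_eqI)
    fix z
    have "peval (lform a * g) (2 *s z) = 2 ^ d * peval (lform a * g) z" by (rule peval_scale[OF f(1)])
    then show "peval (lform a * (cconst 2 * G - cconst (2 ^ d) * g)) z = peval 0 z"
      by (simp add: G peval_lform_scale algebra_simps)
  qed
  then have "cconst 2 * G - cconst (2 ^ d) * g = 0" using mult_eq_0_cpoly l0 by blast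
  then have "cconst 2 * G = cconst (2 ^ d) * g" by simp
  from arg_cong[OF this, of "\<lambda>p. peval p _"]
  have *: "2 * peval g (2 *s z) = 2 ^ d * peval g z" for z by (simp add: G)
  have d: "2 ^ d = 2 * (2::complex) ^ (d - 1)" using f(2) by (cases d) auto
  show hg: "homog (d - 1) g" by (rule homogI) (use *[unfolded d] in simp)
  show "imag_proj g \<subseteq> real_zero_set g"
  proof
    fix y assume "y \<in> imag_proj g"
    then obtain z where z: "peval g z = 0" "y = Im_vec z" by (auto simp: imag_proj_def zero_set_def)
    let ?y = "cvec_of_real y" and ?e = "cvec_of_real e"
    show "y \<in> real_zero_set g"
    proof (rule ccontr)
      assume y: "y \<notin> real_zero_set g"
      have "peval (lform a * g) z = 0" using z by simp
      then have "y \<in> real_zero_set (lform a * g)" using f(3) imag_projI z by blast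
      then have ay: "a \<bullet> y = 0" using y by (simp add: real_zero_set_def peval_lform_real)
      have "coeff (ueval (shift ?y g) z) (d - 1) \<noteq> 0"
        using degree_shift(2)[OF hg] y by (simp add: real_zero_set_def)
      then have "ueval (shift ?y g) z \<noteq> 0" by (metis coeff_0)
      then obtain t1 where t1: "peval g (z + t1 *s ?y) \<noteq> 0"
        using poly_all_0_iff_0 by (metis poly_shift)
      text \<open>Perturbing \<open>z\<close> to a zero of \<open>g\<close> with imaginary part off the hyperplane.\<close>
      have small: "eventually (\<lambda>\<epsilon>::real. \<exists>t. dist t 0 < r \<and> peval g ((z + (of_real \<epsilon> * \<i>) *s ?e) + t *s ?y) = 0) (at_right 0)"
        if "r > 0" for r
      proof (rule line_root_persistence[OF _ tendsto_const _ t1 that])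
        have "((\<lambda>\<epsilon>::real. z + (of_real \<epsilon> * \<i>) *s ?e) \<longlongrightarrow> z + (of_real 0 * \<i>) *s ?e) (at_right 0)"
          by (intro tendsto_intros)
        then show "((\<lambda>\<epsilon>::real. z + (of_real \<epsilon> * \<i>) *s ?e) \<longlongrightarrow> z) (at_right 0)" by simp
      qed (use z in simp)
      \<comment> \<open>The imaginary part of the perturbed zero is
        \<open>Y \<epsilon> (Im t)\<close>. As \<open>a \<bullet> y = 0\<close>, the linear form
        takes the value \<open>\<epsilon> * (a \<bullet> e)\<close> there, whatever \<open>t\<close>
        is.\<close>
      define Y where "Y \<epsilon> s = (1 + s) *\<^sub>R y + \<epsilon> *\<^sub>R e" for \<epsilon> s :: real
      have "((\<lambda>p. peval g (cvec_of_real (Y (fst p) (snd p)))) \<longlongrightarrow>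
          peval g (cvec_of_real (Y (fst (0 :: real \<times> real)) (snd (0 :: real \<times> real))))) (nhds (0 :: real \<times> real))"
        unfolding Y_def
        by (intro tendsto_intros tendsto_fst[OF filterlim_ident] tendsto_snd[OF filterlim_ident])
      moreover have "peval g (cvec_of_real (Y (fst (0 :: real \<times> real)) (snd (0 :: real \<times> real)))) \<noteq> 0"
        using y by (simp add: Y_def real_zero_set_def)
      ultimately have "eventually (\<lambda>p. peval g (cvec_of_real (Y (fst p) (snd p))) \<noteq> 0) (nhds 0)"
        by (rule tendsto_imp_eventually_ne)
      then obtain r where r: "r > 0" "\<And>\<epsilon> s. dist (\<epsilon>, s) (0,0) < r \<Longrightarrow> peval g (cvec_of_real (Y \<epsilon> s)) \<noteq> 0"
        unfolding eventually_nhds_metric zero_prod_def by fastforce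
      have pos: "eventually (\<lambda>\<epsilon>::real. \<epsilon> > 0 \<and> \<epsilon> < r / 2) (at_right 0)"
        using r(1) by (auto simp: eventually_at_right intro!: exI[of _ "r / 2"])
      have "eventually (\<lambda>\<epsilon>::real. (\<epsilon> > 0 \<and> \<epsilon> < r / 2) \<and>
          (\<exists>t. dist t 0 < r / 2 \<and> peval g ((z + (of_real \<epsilon> * \<i>) *s ?e) + t *s ?y) = 0)) (at_right 0)"
        using eventually_conj[OF pos small[of "r / 2"]] r(1) by simp
      then obtain \<epsilon> t where \<epsilon>: "\<epsilon> > 0" "\<epsilon> < r / 2" "dist t 0 < r / 2"
          "peval g ((z + (of_real \<epsilon> * \<i>) *s ?e) + t *s ?y) = 0"
        using eventually_happens'[OF trivial_limit_at_right_real] by blast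
      have Im: "Im_vec ((z + (of_real \<epsilon> * \<i>) *s ?e) + t *s ?y) = Y \<epsilon> (Im t)"
        unfolding Y_def z(2) by (simp add: vec_eq_iff algebra_simps)
      have "peval (lform a * g) ((z + (of_real \<epsilon> * \<i>) *s ?e) + t *s ?y) = 0" using \<epsilon>(4) by simp
      then have "Y \<epsilon> (Im t) \<in> real_zero_set (lform a * g)" using f(3) imag_projI Im by (metis subsetD)
      moreover have "a \<bullet> Y \<epsilon> (Im t) = \<epsilon> * (a \<bullet> e)" by (simp add: Y_def inner_add_right ay)
      then have "peval (lform a) (cvec_of_real (Y \<epsilon> (Im t))) \<noteq> 0"
        unfolding peval_lform_real using \<epsilon>(1) ae by simp
      moreover have "peval g (cvec_of_real (Y \<epsilon> (Im t))) \<noteq> 0"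
      proof (rule r(2))
        have "dist (\<epsilon>, Im t) (0, 0) \<le> \<bar>\<epsilon>\<bar> + \<bar>Im t\<bar>"
          using norm_Pair_le[of \<epsilon> "Im t"] by (simp add: dist_norm)
        also have "\<dots> < r" using \<epsilon> abs_Im_le_cmod[of t] by simp
        finally show "dist (\<epsilon>, Im t) (0, 0) < r" .
      qed
      ultimately show False by (simp add: real_zero_set_def)
    qed
  qed
qed

lemma real_linear_factorization:
  fixes f :: "'n::finite cpoly"
  assumes "f \<noteq> 0" "homog d f" "imag_proj f \<subseteq> real_zero_set f"
  shows "\<exists>c ls. f = cconst c * prod_list ls \<and> (\<forall>l\<in>set ls. real_linear_poly l)"
  using assms
proof (induction d arbitrary: f)
  case 0
  then obtain c where "f = cconst c" using homog_0_const by blast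
  then have "f = cconst c * prod_list [] \<and> (\<forall>l\<in>set []. real_linear_poly l)" by simp
  then show ?case by blast
next
  case (Suc d)
  then obtain a e where ae: "a \<bullet> e \<noteq> 0" and van: "\<And>x. a \<bullet> x = 0 \<Longrightarrow> peval f (cvec_of_real x) = 0"
    using hyperplane_in_real_zero_set[of f "Suc d"] by (metis le_add1 plus_1_eq_Suc)
  obtain g where fg: "f = lform a * g" using linear_factor[OF ae van] by blast
  have "homog d g" "imag_proj g \<subseteq> real_zero_set g"
    using linear_cofactor[of "Suc d" a g e] Suc.prems ae by (auto simp: fg)
  moreover have "g \<noteq> 0" using fg Suc.prems(1) by auto
  ultimately obtain c ls where "g = cconst c * prod_list ls" "\<forall>l\<in>set ls. real_linear_poly l"
    using Suc.IH by blast
  then have "f = cconst c * prod_list (lform a # ls) \<and> (\<forall>l\<in>set (lform a # ls). real_linear_poly l)"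
    using fg real_linear_poly_lform by (simp add: mult_ac)
  then show ?case by blast
qed

lemma unit_multiple_real_linear_factorization:
  fixes f :: "'n::finite cpoly"
  assumes "f \<noteq> 0" "homog d f" "imag_proj f \<subseteq> real_zero_set f"
  shows "\<exists>\<phi>\<in>{0..<2*pi}. \<exists>ls. (\<forall>l\<in>set ls. real_linear_poly l) \<and>
    cconst (exp (\<i> * complex_of_real \<phi>)) * f = prod_list ls"
proof -
  obtain c ls where f: "f = cconst c * prod_list ls" and ls: "\<forall>l\<in>set ls. real_linear_poly l"
    using real_linear_factorization[OF assms] by blast
  \<comment> \<open>The argument of the conjugate rotates \<open>c\<close> to its absolute value;
    this real constant is kept as an additional factor of degree 0.\<close>
  let ?\<phi> = "Arg2pi (cnj c)" and ?r = "cconst (of_real (norm c)) :: 'n cpoly"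
  have c: "exp (\<i> * of_real ?\<phi>) * c = of_real (norm c)"
  proof (cases "c = 0")
    case False
    have "cnj c = of_real (norm c) * exp (\<i> * of_real ?\<phi>)" using Arg2pi_eq[of "cnj c"] by simp
    then have "of_real (norm c) * (exp (\<i> * of_real ?\<phi>) * c) = cnj c * c" by simp
    also have "\<dots> = of_real (norm c) * of_real (norm c)"
      using complex_norm_square[of c] by (simp add: power2_eq_square mult.commute)
    finally show ?thesis using False by simp
  qed simp
  have "mono_deg (0 :: 'n \<Rightarrow>\<^sub>0 nat) = 0" by simp
  then have "real_linear_poly ?r"
    by (auto simp: real_linear_poly_def cconst_def lookup_single when_def simp del: mono_deg_eq_0 split: if_splits)
  moreover have "cconst (exp (\<i> * of_real ?\<phi>)) * f = prod_list (?r # ls)"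
    by (simp add: f mult.assoc[symmetric] cconst_mult c)
  ultimately show ?thesis
    using ls Arg2pi_ge_0[of "cnj c"] Arg2pi_lt_2pi[of "cnj c"]
    by (intro bexI[of _ ?\<phi>] exI[of _ "?r # ls"]) auto
qed

subsection \<open>Locally bounded quotients of polynomials\<close>

text \<open>At a root \<open>c\<close> of \<open>A\<close> the bound passes to the limit and makes
  \<open>B\<close> vanish, so \<open>t - c\<close> cancels. Afterwards the bound is known only for
  \<open>t\<close> different from \<open>c\<close>, hence the punctured neighbourhoods.\<close>

lemma poly_dvd_if_locally_bounded:
  fixes A B :: "complex poly"
  assumes "A \<noteq> 0"
    and "\<And>t0. \<exists>K. eventually (\<lambda>t. poly A t \<noteq> 0 \<longrightarrow> norm (poly B t) \<le> K * norm (poly A t)) (at t0)"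
  shows "A dvd B"
  using assms
proof (induction "degree A" arbitrary: A B)
  case 0
  then have "is_unit A" by (simp add: is_unit_iff_degree)
  then show ?case by (rule unit_imp_dvd)
next
  case (Suc n)
  then have "\<not> constant (poly A)" by (simp add: constant_degree)
  then obtain c where c: "poly A c = 0" using fundamental_theorem_of_algebra by blast
  then obtain A' where A': "A = [:- c, 1:] * A'" by (auto simp: poly_eq_0_iff_dvd)
  have A'0: "A' \<noteq> 0" using Suc.prems(1) A' by auto
  have "degree A = Suc (degree A')" unfolding A' using A'0 by (subst degree_mult_eq) auto
  then have n: "n = degree A'" using Suc.hyps(2) by simp
  obtain K where K: "eventually (\<lambda>t. poly A t \<noteq> 0 \<longrightarrow> norm (poly B t) \<le> K * norm (poly A t)) (at c)"
    using Suc.prems(2) by blast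
  have "finite {t. poly A t = 0}" using Suc.prems(1) by (rule poly_roots_finite)
  then have "open (- ({t. poly A t = 0} - {c}))" by (intro open_Compl finite_imp_closed finite_Diff)
  then have "eventually (\<lambda>t. poly A t \<noteq> 0) (at c)"
    unfolding eventually_at_topological by (rule exI[of _ "- ({t. poly A t = 0} - {c})", OF conjI]) auto
  with K have "eventually (\<lambda>t. norm (poly B t) \<le> K * norm (poly A t)) (at c)"
    by eventually_elim auto
  moreover have "((\<lambda>t. norm (poly B t)) \<longlongrightarrow> norm (poly B c)) (at c)"
    "((\<lambda>t. K * norm (poly A t)) \<longlongrightarrow> K * norm (poly A c)) (at c)"
    by (intro tendsto_intros)+
  ultimately have "norm (poly B c) \<le> K * norm (poly A c)"
    by (intro tendsto_le[OF at_neq_bot])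
  then have "poly B c = 0" using c by simp
  then obtain B' where B': "B = [:- c, 1:] * B'" by (auto simp: poly_eq_0_iff_dvd)
  have "A' dvd B'"
  proof (rule Suc.hyps(1)[OF n A'0])
    fix t0
    obtain K where "eventually (\<lambda>t. poly A t \<noteq> 0 \<longrightarrow> norm (poly B t) \<le> K * norm (poly A t)) (at t0)"
      using Suc.prems(2) by blast
    moreover have "eventually (\<lambda>t. t \<noteq> c) (at t0)" by (rule eventually_neq_at_within)
    ultimately have "eventually (\<lambda>t. poly A' t \<noteq> 0 \<longrightarrow> norm (poly B' t) \<le> K * norm (poly A' t)) (at t0)"
    proof eventually_elim
      case (elim t)
      show ?case
      proof
        assume "poly A' t \<noteq> 0"
        then have "norm (t - c) * norm (poly B' t) \<le> K * (norm (t - c) * norm (poly A' t))"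
          using elim by (simp add: A' B' norm_mult flip: left_diff_distrib)
        then have "norm (t - c) * norm (poly B' t) \<le> norm (t - c) * (K * norm (poly A' t))"
          by (simp add: mult_ac)
        then show "norm (poly B' t) \<le> K * norm (poly A' t)"
          using elim by (simp only: mult_le_cancel_left_pos zero_less_norm_iff right_minus_eq not_False_eq_True)
      qed
    qed
    then show "\<exists>K. eventually (\<lambda>t. poly A' t \<noteq> 0 \<longrightarrow> norm (poly B' t) \<le> K * norm (poly A' t)) (at t0)"
      by blast
  qed
  then show ?case unfolding A' B' by (rule mult_dvd_mono[OF dvd_refl])
qed

text \<open>In a direction \<open>w\<close> where the top-degree form of \<open>a\<close> is
  nonzero, \<open>a(z + t w)\<close> has a constant leading coefficient in \<open>t\<close>. After
  division, the univariate case at each \<open>z\<close> kills the remainder.\<close>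

lemma cpoly_dvd_if_locally_bounded:
  fixes a b :: "'n::finite cpoly"
  assumes a: "a \<noteq> 0"
    and bd: "\<And>z0. \<exists>K. eventually (\<lambda>z. peval a z \<noteq> 0 \<longrightarrow> norm (peval b z) \<le> K * norm (peval a z)) (nhds z0)"
  shows "a dvd b"
proof -
  have ne: "keys a \<noteq> {}"
    using a poly_mapping_sum_single[of a] by (metis sum.empty)
  define D where "D = Max (mono_deg ` keys a)"
  have D: "mono_deg m \<le> D" if "m \<in> keys a" for m using that by (simp add: D_def)
  have "D \<in> mono_deg ` keys a" unfolding D_def using ne by (intro Max_in) auto
  then obtain m where m: "m \<in> keys a" "mono_deg m = D" by auto
  then have "lookup (hcomp D a) m \<noteq> 0" by (simp add: lookup_hcomp in_keys_iff)
  then have "hcomp D a \<noteq> 0" by auto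
  then obtain w where w: "peval (hcomp D a) w \<noteq> 0" using real_nonzero_point by blast
  let ?S = "shift w a"
  define \<kappa> where "\<kappa> = peval (hcomp D a) w"
  have cD: "coeff ?S D = cconst \<kappa>"
    unfolding shift_def \<kappa>_def by (rule peval_eqI, subst coeff_line_subst[OF D]) (auto simp: vec_lambda_eta)
  have nz: "coeff ?S D \<noteq> 0" using cD w peval_cconst[of \<kappa>] unfolding \<kappa>_def by (metis peval_0)
  have deg: "degree ?S = D"
    using degree_line_subst_le[OF D] le_degree[OF nz] unfolding shift_def by (meson antisym)
  obtain q r where qr: "shift w b = ?S * q + r" "r = 0 \<or> degree r < degree ?S"
    using division_unit_lead[of ?S \<kappa>] cD deg w unfolding \<kappa>_def by metis
  have "ueval r z = 0" for z
  proof (rule ccontr)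
    assume r: "ueval r z \<noteq> 0"
    let ?A = "ueval ?S z" and ?B = "ueval (shift w b) z"
    have AD: "coeff ?A D \<noteq> 0" using w by (simp add: cD \<kappa>_def)
    have "?A dvd ?B"
    proof (rule poly_dvd_if_locally_bounded)
      show "?A \<noteq> 0" using AD by (metis coeff_0)
      fix t0
      obtain K where K: "eventually (\<lambda>z. peval a z \<noteq> 0 \<longrightarrow> norm (peval b z) \<le> K * norm (peval a z)) (nhds (z + t0 *s w))"
        using bd by blast
      have "((\<lambda>t. z + t *s w) \<longlongrightarrow> z + t0 *s w) (at t0)" by (intro tendsto_intros)
      from eventually_compose_filterlim[OF K this]
      show "\<exists>K. eventually (\<lambda>t. poly ?A t \<noteq> 0 \<longrightarrow> norm (poly ?B t) \<le> K * norm (poly ?A t)) (at t0)"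
        unfolding poly_shift by blast
    qed
    then have "?A dvd ueval r z" by (simp add: qr(1) dvd_add_right_iff)
    then have "degree ?A \<le> degree (ueval r z)" using r by (rule dvd_imp_degree_le)
    moreover have "D \<le> degree ?A" using AD by (rule le_degree)
    moreover have "r \<noteq> 0" using r by auto
    ultimately show False using qr(2) deg degree_ueval_le[of r z] by simp
  qed
  then have "r = 0" by (intro ueval_eqI) simp
  then have "peval b z = peval (a * poly q (cconst 0)) z" for z
    using arg_cong[OF qr(1), of "\<lambda>P. poly (ueval P z) 0"] by (simp add: poly_ueval[of q])
  then have "b = a * poly q (cconst 0)" by (rule peval_eqI)
  then show ?thesis by simp
qed

section \<open>Bounded roots and factorization\<close>

lemma coeff_bound_roots:
  fixes g :: "complex poly"
  assumes M: "M \<ge> 0" and "\<And>t. poly g t = 0 \<Longrightarrow> norm t \<le> M"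
  shows "norm (coeff g j) \<le> norm (lead_coeff g) * (1 + M) ^ degree g"
  using assms(2)
proof (induction "degree g" arbitrary: g j)
  case 0
  then obtain c where "g = [:c:]" by (metis degree_eq_zeroE)
  then show ?case by (cases j) auto
next
  case (Suc n)
  then have "\<not> constant (poly g)" by (simp add: constant_degree)
  then obtain c where c: "poly g c = 0" using fundamental_theorem_of_algebra by blast
  then obtain h where h: "g = [:- c, 1:] * h" by (auto simp: poly_eq_0_iff_dvd)
  have h0: "h \<noteq> 0" using Suc.hyps(2) h by auto
  have deg: "degree g = Suc (degree h)" unfolding h using h0 by (subst degree_mult_eq) auto
  have lead: "lead_coeff g = lead_coeff h" unfolding h lead_coeff_mult by simp
  let ?b = "norm (lead_coeff h) * (1 + M) ^ degree h"
  have IH: "norm (coeff h j) \<le> ?b" for j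
    by (rule Suc.hyps(1)) (use Suc.hyps(2) deg Suc.prems in \<open>auto simp: h\<close>)
  have "norm c \<le> M" using c Suc.prems by blast
  have b0: "0 \<le> ?b" using M by simp
  have g: "coeff g j = (case j of 0 \<Rightarrow> 0 | Suc i \<Rightarrow> coeff h i) - c * coeff h j"
    by (simp add: h coeff_pCons split: nat.split)
  have "norm (coeff g j) \<le> norm (case j of 0 \<Rightarrow> 0 | Suc i \<Rightarrow> coeff h i) + norm (c * coeff h j)"
    unfolding g by (rule norm_triangle_ineq4)
  \<comment> \<open>Multiplication by \<open>t - c\<close> enlarges a bound on the coefficients at
    most by the factor \<open>1 + M\<close>.\<close>
  also have "\<dots> \<le> ?b + M * ?b"
    unfolding norm_mult using IH b0 M \<open>norm c \<le> M\<close>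
    by (intro add_mono mult_mono) (auto split: nat.split)
  also have "\<dots> = norm (lead_coeff h) * (1 + M) ^ Suc (degree h)"
    by (simp add: algebra_simps)
  also have "\<dots> = norm (lead_coeff g) * (1 + M) ^ degree g"
    using lead by (simp only: deg)
  finally show ?case .
qed

lemma norm_vector_smult: "norm (c *s (z :: complex^'n)) = norm c * norm z"
  by (simp add: norm_vec_def L2_set_right_distrib norm_mult)

text \<open>\<open>f\<close> has no zeros near \<open>e\<close>, whereas a root \<open>t\<close>
  that is large compared with \<open>z\<close> would make \<open>e + z / t\<close> a zero close to
  \<open>e\<close>.\<close>

lemma homog_line_root_bound:
  assumes f: "homog d f" and e: "peval f e \<noteq> 0"
  obtains \<delta> where "\<delta> > 0" "\<And>z t. peval f (z + t *s e) = 0 \<Longrightarrow> \<delta> * norm t \<le> norm z"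
proof -
  have "((\<lambda>u. peval f u) \<longlongrightarrow> peval f e) (nhds e)" by (intro tendsto_intros filterlim_ident)
  then have "eventually (\<lambda>u. peval f u \<noteq> 0) (nhds e)" using e by (rule tendsto_imp_eventually_ne)
  then obtain \<delta> where \<delta>: "\<delta> > 0" "\<And>u. dist u e < \<delta> \<Longrightarrow> peval f u \<noteq> 0"
    unfolding eventually_nhds_metric by blast
  have "\<delta> * norm t \<le> norm z" if "peval f (z + t *s e) = 0" for z t
  proof (rule ccontr)
    assume "\<not> ?thesis"
    then have lt: "norm z < \<delta> * norm t" by simp
    then have t: "t \<noteq> 0" using norm_ge_zero[of z] by auto
    have "dist (e + inverse t *s z) e < \<delta>"
      using lt t by (simp add: dist_norm norm_vector_smult norm_inverse pos_divide_less_eq mult.commute flip: divide_inverse)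
    then have "peval f (t *s (e + inverse t *s z)) \<noteq> 0" unfolding peval_scale[OF f] using \<delta>(2) t by simp
    moreover have "t *s (e + inverse t *s z) = z + t *s e"
      using t by (simp add: vector_add_ldistrib vector_smult_assoc add.commute)
    ultimately show False using that by metis
  qed
  with \<delta>(1) show ?thesis by (rule that)
qed

text \<open>Gauss's lemma for a polynomial with bounded roots: the coefficients of \<open>g\<close> divided by the leading
  one are locally bounded, hence polynomials.\<close>

lemma monic_factor:
  fixes F g q :: "'n::finite cpoly poly"
  assumes \<delta>: "\<delta> > 0" "\<And>z t. poly (ueval F z) t = 0 \<Longrightarrow> \<delta> * norm t \<le> norm z"
    and g: "g \<noteq> 0" "smult (lead_coeff g ^ N) F = g * q"
  obtains G Q where "F = G * Q" "degree G = degree g" "lead_coeff G = 1"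
proof -
  let ?a = "lead_coeff g" and ?k = "degree g"
  have a0: "?a \<noteq> 0" using g(1) by simp
  have dvdF: "ueval g z dvd ueval F z" if "peval ?a z \<noteq> 0" for z
  proof -
    have "smult (peval ?a z ^ N) (ueval F z) = ueval g z * ueval q z"
      using arg_cong[OF g(2), of "\<lambda>P. ueval P z"] by simp
    then have "ueval g z dvd smult (peval ?a z ^ N) (ueval F z)" by simp
    then show ?thesis using that by (simp add: dvd_smult_iff)
  qed
  \<comment> \<open>Where \<open>?a\<close> is nonzero, the roots of \<open>g\<close> are among
    those of \<open>F\<close>, hence locally bounded, and they bound the coefficients of
    \<open>g\<close> relative to \<open>?a\<close>.\<close>
  have "?a dvd coeff g j" for j
  proof (rule cpoly_dvd_if_locally_bounded[OF a0])
    fix z0 :: "complex^'n"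
    define M where "M = (norm z0 + 1) / \<delta>"
    have M: "M \<ge> 0" unfolding M_def using \<delta>(1) by simp
    have "eventually (\<lambda>z. dist z z0 < 1) (nhds z0)"
      by (auto simp: eventually_nhds_metric intro: exI[of _ 1])
    then have "eventually (\<lambda>z. peval ?a z \<noteq> 0 \<longrightarrow> norm (peval (coeff g j) z) \<le> (1 + M) ^ ?k * norm (peval ?a z)) (nhds z0)"
    proof eventually_elim
      case (elim z)
      show ?case
      proof
        assume az: "peval ?a z \<noteq> 0"
        have deg: "degree (ueval g z) = ?k"
          using degree_ueval_le[of g z] le_degree[of "ueval g z" ?k] az by simp
        have root: "norm t \<le> M" if "poly (ueval g z) t = 0" for t
        proof -
          have "poly (ueval F z) t = 0" using dvdF[OF az] that by (auto elim!: dvdE)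
          then have "\<delta> * norm t \<le> norm z" by (rule \<delta>(2))
          also have "\<dots> \<le> norm z0 + 1"
            using elim norm_triangle_sub[of z z0] by (simp add: dist_norm)
          finally show ?thesis unfolding M_def using \<delta>(1) by (simp add: field_simps)
        qed
        from coeff_bound_roots[of M "ueval g z" j, OF M root] deg
        show "norm (peval (coeff g j) z) \<le> (1 + M) ^ ?k * norm (peval ?a z)"
          by (simp add: mult.commute)
      qed
    qed
    then show "\<exists>K. eventually (\<lambda>z. peval ?a z \<noteq> 0 \<longrightarrow> norm (peval (coeff g j) z) \<le> K * norm (peval ?a z)) (nhds z0)"
      by blast
  qed
  then have "\<exists>c. coeff g j = ?a * c" for j by (meson dvdE)
  then obtain c where c: "\<And>j. coeff g j = ?a * c j" by metis
  define G where "G = (\<Sum>j<?k. monom (c j) j) + monom 1 ?k"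
  have cG: "coeff G j = (if j < ?k then c j else if j = ?k then 1 else 0)" for j
    by (auto simp: G_def coeff_sum)
  have aG: "smult ?a G = g"
    by (rule poly_eqI) (auto simp: cG c[symmetric] coeff_eq_0)
  have degG: "degree G = ?k"
    by (rule antisym, rule degree_le) (auto simp: cG intro: le_degree)
  have leadG: "lead_coeff G = 1" by (simp add: degG cG)
  obtain Q r where Qr: "F = G * Q + r" "r = 0 \<or> degree r < degree G"
    using division_unit_lead[of G 1 F] leadG by (metis cconst_1 one_neq_zero)
  have "coeff r j = 0" for j
  proof -
    \<comment> \<open>Off the zeros of \<open>?a\<close>, the specialised \<open>G\<close> divides
      the specialised \<open>F\<close> and hence the remainder of smaller degree. The factor
      \<open>?a\<close> takes care of its zeros.\<close>
    have "?a * coeff r j = 0"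
    proof (rule peval_eqI)
      fix z
      have "peval (coeff r j) z = 0" if az: "peval ?a z \<noteq> 0"
      proof (rule ccontr)
        assume "peval (coeff r j) z \<noteq> 0"
        then have r: "ueval r z \<noteq> 0" by (metis coeff_0 coeff_ueval)
        have "ueval G z dvd ueval g z"
          using arg_cong[OF aG, of "\<lambda>P. ueval P z"] by (metis dvd_smult dvd_refl ueval_smult)
        then have "ueval G z dvd ueval F z" using dvdF[OF az] dvd_trans by blast
        then have "ueval G z dvd ueval r z" by (simp add: Qr(1) dvd_add_right_iff)
        then have "degree (ueval G z) \<le> degree (ueval r z)" using r by (rule dvd_imp_degree_le)
        moreover have "?k \<le> degree (ueval G z)" by (rule le_degree) (simp add: cG)
        moreover have "r \<noteq> 0" using r by auto
        ultimately show False using Qr(2) degG degree_ueval_le[of r z] by simp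
      qed
      then show "peval (?a * coeff r j) z = peval 0 z" by auto
    qed
    then show ?thesis using mult_eq_0_cpoly a0 by blast
  qed
  then have "r = 0" by (intro poly_eqI) simp
  then show ?thesis using that[of G Q] Qr(1) degG leadG by simp
qed

text \<open>The projection \<open>z \<mapsto> z - (z\<^sub>i / e\<^sub>i) e\<close> splits \<open>\<complex>[z]\<close> as polynomials in \<open>z\<^sub>i / e\<^sub>i\<close>, so that a factorization of
  \<open>f(z + t e)\<close> over \<open>\<complex>[z][t]\<close> yields one of \<open>f\<close>.\<close>

lemma factor_descent:
  fixes f :: "'n::finite cpoly"
  assumes F: "shift e f = G * Q" and ei: "e $ i \<noteq> 0"
  obtains G' Q' where "f = G' * Q'" "\<And>s. peval G' (s *s e) = poly (ueval G 0) s"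
    "\<And>s. peval Q' (s *s e) = poly (ueval Q 0) s"
proof -
  define \<pi> where "\<pi> z = z - (z $ i / e $ i) *s e" for z
  have sub: "\<exists>c'. \<forall>z. peval c' z = peval c (\<pi> z)" for c :: "'n cpoly"
  proof -
    let ?A = "\<lambda>j. Var j - cconst (e $ j / e $ i) * Var i"
    let ?c = "poly (line_subst c ?A (\<lambda>_. 0)) (cconst 0)"
    have "peval ?c z = peval c (\<pi> z)" for z
    proof -
      have "(\<chi> j. peval (?A j) z + 0 * peval 0 z) = \<pi> z"
        by (simp add: vec_eq_iff \<pi>_def)
      then show ?thesis using poly_line_subst[of c ?A "\<lambda>_. 0" z 0] unfolding poly_ueval by simp
    qed
    then show ?thesis by blast
  qed
  then obtain \<sigma> where \<sigma>: "\<And>c z. peval (\<sigma> c) z = peval c (\<pi> z)" by metis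
  \<comment> \<open>\<open>hat\<close> undoes the shift: it evaluates at the decomposition of
    \<open>z\<close> into \<open>\<pi> z\<close> and the multiple \<open>z $ i / e $ i\<close> of
    \<open>e\<close>.\<close>
  define hat where "hat P = (\<Sum>j\<le>degree P. \<sigma> (coeff P j) * (cconst (1 / e $ i) * Var i) ^ j)" for P
  have hat: "peval (hat P) z = poly (ueval P (\<pi> z)) (z $ i / e $ i)" for P z
    by (simp add: hat_def \<sigma> poly_ueval poly_altdef[of P])
  have \<pi>0: "\<pi> (s *s e) = 0" for s using ei by (simp add: \<pi>_def vec_eq_iff)
  show ?thesis
  proof
    show "f = hat G * hat Q"
    proof (rule peval_eqI)
      fix z
      have "peval f z = peval f (\<pi> z + (z $ i / e $ i) *s e)" by (simp add: \<pi>_def)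
      also have "\<dots> = poly (ueval (G * Q) (\<pi> z)) (z $ i / e $ i)" by (simp flip: F)
      finally show "peval f z = peval (hat G * hat Q) z" by (simp add: hat)
    qed
    show "peval (hat G) (s *s e) = poly (ueval G 0) s" for s using ei by (simp add: hat \<pi>0)
    show "peval (hat Q) (s *s e) = poly (ueval Q 0) s" for s using ei by (simp add: hat \<pi>0)
  qed
qed

section \<open>Polynomials vanishing on a transversal set\<close>

lemma not_unit_if_root: "peval p z = 0 \<Longrightarrow> \<not> p dvd 1"
proof
  assume p: "peval p z = 0" and "p dvd 1"
  from \<open>p dvd 1\<close> obtain q where "1 = p * q" by (rule dvdE)
  then have "peval 1 z = peval p z * peval q z" by (metis peval_mult)
  then show False using p by simp
qed

lemma irreducible_homog_degree_pos:
  assumes "irreducible f" "homog d f" shows "d \<ge> 1"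
proof (rule ccontr)
  assume "\<not> d \<ge> 1"
  then have "d = 0" by simp
  then have "homog 0 f" using assms(2) by simp
  then obtain c where c: "f = cconst c" by (rule homog_0_const)
  have "c \<noteq> 0" using assms(1) c by (auto simp: cconst_def)
  then have "1 = f * cconst (inverse c)" by (simp add: c cconst_mult)
  then have "f dvd 1" by (rule dvdI)
  then show False using assms(1) by (simp add: irreducible_def)
qed

text \<open>If \<open>S\<close> meets every real line in direction \<open>e\<close>, then a relation of \<open>t\<close>-degree less than \<open>d\<close> between the
  points of \<open>S\<close> would make \<open>f\<close> reducible.\<close>

lemma vanishing_on_transversal_set:
  fixes f p :: "'n::finite cpoly" and S :: "(real^'n) set"
  assumes f: "homog d f" "irreducible f" and e: "peval f (cvec_of_real e) \<noteq> 0"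
    and S: "\<And>x. x \<in> S \<Longrightarrow> peval f (cvec_of_real x) = 0" "\<And>x. \<exists>t. x + t *\<^sub>R e \<in> S"
    and p: "\<And>x. x \<in> S \<Longrightarrow> peval p (cvec_of_real x) = 0"
  shows "f dvd p"
proof -
  let ?e = "cvec_of_real e"
  have d: "d \<ge> 1" using irreducible_homog_degree_pos f by blast
  define J where "J P \<longleftrightarrow> (\<forall>x t. x + t *\<^sub>R e \<in> S \<longrightarrow> poly (ueval P (cvec_of_real x)) (of_real t) = 0)"
    for P :: "'n cpoly poly"
  have Jshift: "J (shift ?e u)" if "\<And>x. x \<in> S \<Longrightarrow> peval u (cvec_of_real x) = 0" for u
    unfolding J_def
  proof (intro allI impI)
    fix x t assume "x + t *\<^sub>R e \<in> S"
    from that[OF this] show "poly (ueval (shift ?e u) (cvec_of_real x)) (of_real t) = 0" by simp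
  qed
  \<comment> \<open>Relations are closed under pseudo-remainders, so a relation of least degree
    pseudo-divides every other one.\<close>
  have Jrem: "J r" if "J P" "J D" "smult c P = D * q + r" for P D c q r
    unfolding J_def
  proof (intro allI impI)
    fix x t assume "x + t *\<^sub>R e \<in> S"
    then have "poly (ueval P (cvec_of_real x)) (of_real t) = 0" "poly (ueval D (cvec_of_real x)) (of_real t) = 0"
      using that(1,2) by (auto simp: J_def)
    then show "poly (ueval r (cvec_of_real x)) (of_real t) = 0"
      using arg_cong[OF that(3), of "\<lambda>P. poly (ueval P (cvec_of_real x)) (of_real t)"] by simp
  qed
  let ?F = "shift ?e f"
  define \<kappa> where "\<kappa> = peval f ?e"
  have cd: "coeff ?F d = cconst \<kappa>" unfolding \<kappa>_def by (rule degree_shift(2)[OF f(1)])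
  have \<kappa>: "\<kappa> \<noteq> 0" using e by (simp add: \<kappa>_def)
  have "coeff ?F d \<noteq> 0" using cd \<kappa> peval_cconst[of \<kappa>] by (metis peval_0)
  then have degF: "degree ?F = d" and F0: "?F \<noteq> 0"
    using degree_shift(1)[OF f(1)] le_degree by (metis antisym, metis coeff_0)
  have JF: "J ?F" by (rule Jshift[OF S(1)])
  define k where "k = (LEAST k. \<exists>g. g \<noteq> 0 \<and> J g \<and> degree g = k)"
  have "\<exists>k g. g \<noteq> 0 \<and> J g \<and> degree g = k" using F0 JF by blast
  then have "\<exists>g. g \<noteq> 0 \<and> J g \<and> degree g = k" unfolding k_def by (rule LeastI_ex)
  then obtain g where g: "g \<noteq> 0" "J g" "degree g = k" by blast
  have least: "P = 0" if "J P" "degree P < k" for P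
    using not_less_Least[of "degree P" "\<lambda>k. \<exists>g. g \<noteq> 0 \<and> J g \<and> degree g = k"] that
    unfolding k_def by blast
  \<comment> \<open>A relation free of \<open>t\<close> would vanish at all real points, because
    every real line in direction \<open>e\<close> meets \<open>S\<close>.\<close>
  have k: "k \<ge> 1"
  proof (rule ccontr)
    assume "\<not> k \<ge> 1"
    then obtain c where c: "g = [:c:]" using g(3) by (metis degree_eq_zeroE less_one not_less)
    have "c = 0"
    proof (rule peval_eq_0_on_reals)
      fix x :: "real^'n"
      obtain t where "x + t *\<^sub>R e \<in> S" using S(2) by blast
      then have "poly (ueval g (cvec_of_real x)) (of_real t) = 0" using g(2) by (simp add: J_def)
      then show "peval c (cvec_of_real x) = 0" by (simp add: c poly_ueval)
    qed
    then show False using g(1) c by simp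
  qed
  have "\<not> k < d"
  proof
    assume kd: "k < d"
    obtain q r where qr: "pseudo_divmod ?F g = (q, r)" by (cases "pseudo_divmod ?F g")
    define N where "N = Suc (degree ?F) - degree g"
    note pd = pseudo_divmod[OF g(1) qr, folded N_def]
    have "J r" by (rule Jrem[OF JF g(2) pd(1)])
    then have "r = 0" using pd(2) least g(3) by blast
    then have gq: "smult (lead_coeff g ^ N) ?F = g * q" using pd(1) by simp
    obtain \<delta> where \<delta>: "\<delta> > 0" "\<And>z t. peval f (z + t *s ?e) = 0 \<Longrightarrow> \<delta> * norm t \<le> norm z"
      using homog_line_root_bound[OF f(1) e] by blast
    obtain G Q where GQ: "?F = G * Q" "degree G = degree g" "lead_coeff G = 1"
      using monic_factor[of \<delta> ?F g N q] \<delta> g(1) gq by auto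
    have "peval f ?e \<noteq> peval f (0 *s ?e)" using e d unfolding peval_scale[OF f(1)] by (simp add: zero_power)
    then have "?e \<noteq> 0" by auto
    then obtain i where i: "?e $ i \<noteq> 0" by (auto simp: vec_eq_iff)
    obtain G' Q' where G'Q': "f = G' * Q'" "\<And>s. peval G' (s *s ?e) = poly (ueval G 0) s"
        "\<And>s. peval Q' (s *s ?e) = poly (ueval Q 0) s"
      using factor_descent[OF GQ(1) i] by blast
    \<comment> \<open>Both factors must be nonunits. Specialised at \<open>z = 0\<close>,
      \<open>G\<close> is monic of degree \<open>k \<ge> 1\<close>, and at least degree
      \<open>d - k\<close> is left for \<open>Q\<close>; so both have roots, which become zeros of
      \<open>G'\<close> and \<open>Q'\<close>.\<close>
    have G0: "coeff (ueval G 0) k = 1" using GQ(2,3) g(3) by simp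
    obtain s where "poly (ueval G 0) s = 0" using poly_has_root[of "ueval G 0" k] G0 k by auto
    then have "\<not> G' dvd 1" using G'Q'(2) not_unit_if_root by metis
    moreover have "\<not> Q' dvd 1"
    proof -
      have F0: "ueval ?F 0 = ueval G 0 * ueval Q 0" by (simp add: GQ(1))
      have "coeff (ueval ?F 0) d \<noteq> 0" using cd \<kappa> by simp
      then have "d \<le> degree (ueval G 0 * ueval Q 0)" unfolding F0[symmetric] by (rule le_degree)
      also have "\<dots> \<le> k + degree (ueval Q 0)"
        using degree_mult_le[of "ueval G 0" "ueval Q 0"] degree_ueval_le[of G 0] GQ(2) g(3) by simp
      finally have "degree (ueval Q 0) \<ge> 1" using kd by simp
      then obtain s where "poly (ueval Q 0) s = 0"
        using poly_has_root[of "ueval Q 0" "degree (ueval Q 0)"] by (metis leading_coeff_0_iff degree_0 not_one_le_zero)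
      then show ?thesis using G'Q'(3) not_unit_if_root by metis
    qed
    ultimately show False using f(2) G'Q'(1) by (auto simp: irreducible_def)
  qed
  obtain q r where qr: "shift ?e p = ?F * q + r" "r = 0 \<or> degree r < degree ?F"
    using division_unit_lead[of ?F \<kappa>] cd degF \<kappa> by metis
  have "J r" using Jrem[of "shift ?e p" ?F 1 q r] Jshift[OF p] JF qr(1) by simp
  then have "r = 0" using qr(2) least degF \<open>\<not> k < d\<close> by auto
  then have "peval p z = peval (f * poly q (cconst 0)) z" for z
    using arg_cong[OF qr(1), of "\<lambda>P. poly (ueval P z) 0"] by (simp add: poly_ueval[of q])
  then have "p = f * poly q (cconst 0)" by (rule peval_eqI)
  then show ?thesis by simp
qed

subsection \<open>Hyperbolicity cones\<close>

lemma homog_nonzero_on_line: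
  assumes "homog d f" "peval f w \<noteq> 0"
  obtains t where "peval f (z + t *s w) \<noteq> 0"
proof -
  have "coeff (ueval (shift w f) z) d \<noteq> 0" using degree_shift(2)[OF assms(1)] assms(2) by simp
  then have "ueval (shift w f) z \<noteq> 0" by (metis coeff_0)
  then show ?thesis using poly_all_0_iff_0 that by (metis poly_shift)
qed

text \<open>Garding's argument: the roots \<open>t\<close> of \<open>f(\<alpha> i e + s x + t y)\<close> never cross the real axis as \<open>s\<close> runs from
  \<open>1\<close> to \<open>0\<close>.\<close>

lemma hyperbolic_direction_ray:
  fixes f :: "'n::finite cpoly"
  assumes f: "homog d f" and e: "e \<notin> imag_proj f"
    and y: "\<And>s. s \<ge> 0 \<Longrightarrow> peval f (cvec_of_real (y + s *\<^sub>R e)) \<noteq> 0"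
  shows "y \<notin> imag_proj f"
proof
  let ?e = "cvec_of_real e" and ?y = "cvec_of_real y"
  assume "y \<in> imag_proj f"
  then obtain x where x: "peval f (cvec_of_real x + \<i> *s ?y) = 0" unfolding in_imag_proj_iff by blast
  let ?x = "cvec_of_real x"
  have fy: "peval f ?y \<noteq> 0" using y[of 0] by simp
  obtain t1 where t1: "peval f (?x + t1 *s ?y) \<noteq> 0" using homog_nonzero_on_line[OF f fy] by blast
  \<comment> \<open>The small shift by \<open>\<alpha> * \<i>\<close> along \<open>e\<close> keeps
    all roots off the real axis, while the root \<i> for \<open>s = 1\<close> moves only within the
    upper half-plane.\<close>
  define Z where "Z \<alpha> s = of_real s *s ?x + (of_real \<alpha> * \<i>) *s ?e" for \<alpha> s :: real
  have "eventually (\<lambda>\<alpha>. \<exists>t. dist t \<i> < 1 \<and> peval f (Z \<alpha> 1 + t *s ?y) = 0) (at_right 0)"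
  proof (rule line_root_persistence[OF _ tendsto_const x t1])
    have "((\<lambda>\<alpha>. Z \<alpha> 1) \<longlongrightarrow> Z 0 1) (at_right 0)" unfolding Z_def by (intro tendsto_intros)
    then show "((\<lambda>\<alpha>. Z \<alpha> 1) \<longlongrightarrow> ?x) (at_right 0)" by (simp add: Z_def)
  qed simp
  moreover have "eventually (\<lambda>\<alpha>::real. \<alpha> > 0) (at_right 0)" by (simp add: eventually_at_right_less)
  ultimately have "eventually (\<lambda>\<alpha>. \<alpha> > 0 \<and> (\<exists>t. dist t \<i> < 1 \<and> peval f (Z \<alpha> 1 + t *s ?y) = 0)) (at_right 0)"
    by eventually_elim auto
  then obtain \<alpha> t0 where \<alpha>: "\<alpha> > 0" and t0: "dist t0 \<i> < 1" "peval f (Z \<alpha> 1 + t0 *s ?y) = 0"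
    using eventually_happens'[OF trivial_limit_at_right_real] by blast
  have "\<bar>Im (t0 - \<i>)\<bar> < 1" using t0(1) abs_Im_le_cmod[of "t0 - \<i>"] by (simp add: dist_norm)
  then have Im0: "Im t0 > 0" by auto
  have noreal: "Im t \<noteq> 0" if "peval f (Z \<alpha> s + t *s ?y) = 0" for s t
  proof
    assume "Im t = 0"
    then have "t = of_real (Re t)" by (simp add: complex_eq_iff)
    then have "Z \<alpha> s + t *s ?y = cvec_of_real (s *\<^sub>R x + Re t *\<^sub>R y) + (of_real \<alpha> * \<i>) *s ?e"
      by (simp add: Z_def add_ac)
    then have "peval f (cvec_of_real (s *\<^sub>R x + Re t *\<^sub>R y) + (of_real \<alpha> * \<i>) *s ?e) = 0" using that by simp
    then have "e \<in> imag_proj f" by (rule imag_proj_line[OF f]) (use \<alpha> in simp)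
    then show False using e by simp
  qed
  \<comment> \<open>The parameters with a root in the upper half-plane. This set is closed by
    compactness, open by persistence of roots, and contains 1, hence also 0.\<close>
  define A where "A = {s \<in> {0..1}. \<exists>t. Im t > 0 \<and> peval f (Z \<alpha> s + t *s ?y) = 0}"
  obtain \<delta> where \<delta>: "\<delta> > 0" "\<And>z t. peval f (z + t *s ?y) = 0 \<Longrightarrow> \<delta> * norm t \<le> norm z"
    using homog_line_root_bound[OF f fy] by blast
  have contZ: "continuous_on T (\<lambda>p. Z \<alpha> (g p))" if "continuous_on T g" for T and g :: "'b::topological_space \<Rightarrow> real"
    using that unfolding continuous_on_def Z_def by (auto intro!: tendsto_intros)
  have "bounded (Z \<alpha> ` {0..1})"
    by (intro compact_imp_bounded compact_continuous_image contZ) (auto intro: continuous_intros)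
  then obtain R where R: "\<And>s. s \<in> {0..1} \<Longrightarrow> norm (Z \<alpha> s) \<le> R" unfolding bounded_iff by blast
  \<comment> \<open>Admitting \<open>Im t = 0\<close> makes \<open>K\<close> compact; its projection
    is still \<open>A\<close>, since there are no real roots.\<close>
  define K where "K = ({0..1} \<times> (cball 0 (R / \<delta>) \<inter> {t. Im t \<ge> 0})) \<inter>
      {p. peval f (Z \<alpha> (fst p) + snd p *s ?y) = 0}"
  have "compact K"
  proof -
    have c: "continuous_on UNIV (\<lambda>p::real \<times> complex. peval f (Z \<alpha> (fst p) + snd p *s ?y))"
      unfolding continuous_on_def Z_def
      by (intro ballI tendsto_intros)
    have "closed {p. peval f (Z \<alpha> (fst p) + snd p *s ?y) = 0}"
      by (rule closed_Collect_eq[OF c continuous_on_const])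
    then show ?thesis unfolding K_def
      by (intro compact_Int_closed compact_Times compact_Icc compact_cball closed_halfspace_Im_ge)
  qed
  have AK: "A = fst ` K"
  proof (intro set_eqI iffI)
    fix s assume "s \<in> A"
    then obtain t where s: "s \<in> {0..1}" and t: "Im t > 0" "peval f (Z \<alpha> s + t *s ?y) = 0" by (auto simp: A_def)
    have "\<delta> * norm t \<le> R" using \<delta>(2)[OF t(2)] R[OF s] by simp
    then have "(s, t) \<in> K" using s t \<delta>(1) by (simp add: K_def field_simps)
    then show "s \<in> fst ` K" by force
  next
    fix s assume "s \<in> fst ` K"
    then obtain t where t: "s \<in> {0..1}" "Im t \<ge> 0" "peval f (Z \<alpha> s + t *s ?y) = 0" by (auto simp: K_def)
    then show "s \<in> A" using noreal[OF t(3)] by (force simp: A_def)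
  qed
  have "compact (fst ` K)"
    by (rule compact_continuous_image[OF _ \<open>compact K\<close>]) (intro continuous_intros)
  then have "closed A" unfolding AK by (rule compact_imp_closed)
  then have "closedin (top_of_set {0..1}) A" by (rule closed_subset[rotated]) (auto simp: A_def)
  moreover have "openin (top_of_set {0..1}) A"
    unfolding openin_euclidean_subtopology_iff
  proof (intro conjI ballI)
    fix s assume "s \<in> A"
    then obtain t where s: "s \<in> {0..1}" and t: "Im t > 0" "peval f (Z \<alpha> s + t *s ?y) = 0" by (auto simp: A_def)
    obtain t2 where t2: "peval f (Z \<alpha> s + t2 *s ?y) \<noteq> 0" using homog_nonzero_on_line[OF f fy] by blast
    have "((\<lambda>s'. Z \<alpha> s') \<longlongrightarrow> Z \<alpha> s) (nhds s)" unfolding Z_def by (intro tendsto_intros filterlim_ident)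
    from line_root_persistence[OF this tendsto_const t(2) t2 t(1)]
    obtain r where r: "r > 0" "\<And>s'. dist s' s < r \<Longrightarrow> \<exists>t'. dist t' t < Im t \<and> peval f (Z \<alpha> s' + t' *s ?y) = 0"
      unfolding eventually_nhds_metric by blast
    have "s' \<in> A" if "s' \<in> {0..1}" "dist s' s < r" for s'
    proof -
      obtain t' where t': "dist t' t < Im t" "peval f (Z \<alpha> s' + t' *s ?y) = 0" using r(2) \<open>dist s' s < r\<close> by blast
      have "\<bar>Im (t' - t)\<bar> < Im t" using t'(1) abs_Im_le_cmod[of "t' - t"] by (simp add: dist_norm)
      then have "Im t' > 0" by auto
      then show ?thesis using t' that by (auto simp: A_def)
    qed
    then show "\<exists>r>0. \<forall>s'\<in>{0..1}. dist s' s < r \<longrightarrow> s' \<in> A" using r(1) by blast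
  qed (auto simp: A_def)
  ultimately have "A = {} \<or> A = {0..1}"
    using connected_Icc[of 0 "1::real"] unfolding connected_clopen by blast
  moreover have "1 \<in> A" using t0 Im0 by (auto simp: A_def)
  ultimately have "0 \<in> A" by auto
  then obtain t where t: "Im t > 0" "peval f (Z \<alpha> 0 + t *s ?y) = 0" by (auto simp: A_def)
  have tn: "t \<noteq> 0" using t(1) by auto
  \<comment> \<open>At \<open>s = 0\<close>, dividing by \<open>t\<close> gives a zero
    \<open>y + \<sigma> e\<close>. As \<open>e\<close> is not in the imaginary projection, \<sigma>
    is real, and \<open>\<sigma> * t = \<alpha> * \<i>\<close> makes it positive, against the
    assumption on the ray.\<close>
  define \<sigma> where "\<sigma> = of_real \<alpha> * \<i> / t"
  have "Z \<alpha> 0 + t *s ?y = t *s (?y + \<sigma> *s ?e)"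
    using tn by (simp add: Z_def \<sigma>_def vector_add_ldistrib vector_smult_assoc add.commute)
  then have "peval f (t *s (?y + \<sigma> *s ?e)) = 0" using t(2) by metis
  then have 0: "peval f (?y + \<sigma> *s ?e) = 0" unfolding peval_scale[OF f] using tn by simp
  have Im\<sigma>: "Im \<sigma> = 0" using imag_proj_line[OF f 0] e by blast
  have "\<sigma> * t = of_real \<alpha> * \<i>" using tn by (simp add: \<sigma>_def)
  then have "Re \<sigma> * Im t = \<alpha>" using Im\<sigma> by (auto simp: complex_eq_iff)
  then have "Re \<sigma> \<ge> 0" using \<alpha> t(1) by (metis less_eq_real_def zero_less_mult_pos2)
  moreover have "\<sigma> = of_real (Re \<sigma>)" using Im\<sigma> by (simp add: complex_eq_iff)
  then have "peval f (cvec_of_real (y + Re \<sigma> *\<^sub>R e)) = 0" using 0 by simp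
  ultimately show False using y by blast
qed

text \<open>On a ball around \<open>e\<close> on which \<open>f\<close> has no real zeros, every
  point \<open>y + s e\<close> with \<open>s \<ge> 0\<close> is a positive multiple of a point of
  the ball, so the ray criterion applies to each \<open>y\<close> in it.\<close>

lemma open_compl_imag_proj:
  fixes f :: "'n::finite cpoly"
  assumes f: "homog d f" shows "open (UNIV - imag_proj f)"
  unfolding open_dist
proof
  fix e assume e: "e \<in> UNIV - imag_proj f"
  then have fe: "peval f (cvec_of_real e) \<noteq> 0"
    using real_zero_set_subset_imag_proj[OF f] by (auto simp: real_zero_set_def)
  have "((\<lambda>u. peval f (cvec_of_real u)) \<longlongrightarrow> peval f (cvec_of_real e)) (nhds e)"
    by (intro tendsto_intros filterlim_ident)
  then have "eventually (\<lambda>u. peval f (cvec_of_real u) \<noteq> 0) (nhds e)" using fe by (rule tendsto_imp_eventually_ne)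
  then obtain \<delta> where \<delta>: "\<delta> > 0" "\<And>u. dist u e < \<delta> \<Longrightarrow> peval f (cvec_of_real u) \<noteq> 0"
    unfolding eventually_nhds_metric by blast
  have "y \<in> UNIV - imag_proj f" if y: "dist y e < \<delta>" for y
  proof -
    have "y \<notin> imag_proj f"
    proof (rule hyperbolic_direction_ray[OF f])
      fix s :: real assume s: "s \<ge> 0"
      define u where "u = e + inverse (1 + s) *\<^sub>R (y - e)"
      have "dist u e = inverse (1 + s) * dist y e" using s by (simp add: u_def dist_norm)
      also have "\<dots> \<le> 1 * dist y e" using s by (intro mult_right_mono) (auto simp: field_simps)
      finally have "peval f (cvec_of_real u) \<noteq> 0" using y by (intro \<delta>(2)) simp
      moreover have "y + s *\<^sub>R e = (1 + s) *\<^sub>R u"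
      proof -
        have "(1 + s) *\<^sub>R u = (1 + s) *\<^sub>R e + ((1 + s) * inverse (1 + s)) *\<^sub>R (y - e)"
          by (simp only: u_def scaleR_add_right scaleR_scaleR)
        also have "(1 + s) * inverse (1 + s) = 1" using s by simp
        finally show ?thesis by (simp add: algebra_simps)
      qed
      moreover have "complex_of_real (1 + s) \<noteq> 0" using s by (simp only: of_real_eq_0_iff)
      ultimately show "peval f (cvec_of_real (y + s *\<^sub>R e)) \<noteq> 0"
        by (simp only: cvec_of_real_scaleR peval_scale[OF f] mult_eq_0_iff power_eq_0_iff simp_thms)
    qed (use e in simp)
    then show ?thesis by simp
  qed
  then show "\<exists>\<delta>>0. \<forall>y. dist y e < \<delta> \<longrightarrow> y \<in> UNIV - imag_proj f" using \<delta>(1) by blast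
qed

text \<open>If \<open>f\<close> were nonzero at \<open>b\<close>, a root \<i> in direction
  \<open>b\<close> would persist as a nonreal root in nearby directions outside the imaginary
  projection, which have only real roots.\<close>

lemma frontier_compl_imag_proj:
  fixes f :: "'n::finite cpoly"
  assumes f: "homog d f" and b: "b \<in> frontier (UNIV - imag_proj f)"
  shows "peval f (cvec_of_real b) = 0"
proof (rule ccontr)
  assume nz: "peval f (cvec_of_real b) \<noteq> 0"
  have "b \<in> closure (UNIV - imag_proj f)" and "b \<in> imag_proj f"
    using b open_compl_imag_proj[OF f] by (auto simp: frontier_def interior_open)
  then obtain y x where y: "\<And>k. y k \<in> UNIV - imag_proj f" "y \<longlonglongrightarrow> b"
      and x: "peval f (cvec_of_real x + \<i> *s cvec_of_real b) = 0"
    unfolding closure_sequential in_imag_proj_iff by blast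
  obtain t1 where t1: "peval f (cvec_of_real x + t1 *s cvec_of_real b) \<noteq> 0"
    using homog_nonzero_on_line[OF f nz] by blast
  have "eventually (\<lambda>k. \<exists>t. dist t \<i> < 1 \<and> peval f (cvec_of_real x + t *s cvec_of_real (y k)) = 0) sequentially"
    by (rule line_root_persistence[OF tendsto_const _ x t1]) (auto intro: tendsto_intros y)
  then obtain k t where t: "dist t \<i> < 1" "peval f (cvec_of_real x + t *s cvec_of_real (y k)) = 0"
    using eventually_happens'[OF sequentially_bot] by blast
  have "\<bar>Im (t - \<i>)\<bar> < 1" using t(1) abs_Im_le_cmod[of "t - \<i>"] by (simp add: dist_norm)
  then have "Im t \<noteq> 0" by auto
  then have "y k \<in> imag_proj f" by (rule imag_proj_line[OF f t(2)])
  then show False using y(1) by blast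
qed

text \<open>Far out, the line runs in the open complement, because \<open>x + t e\<close> is a
  multiple of a point close to \<open>e\<close>; it also contains a real zero of \<open>f\<close>. A
  connected set meeting both sides meets the frontier.\<close>

lemma line_meets_frontier:
  fixes f :: "'n::finite cpoly"
  assumes f: "homog d f" "d \<ge> 1" and e: "e \<notin> imag_proj f"
  shows "\<exists>t. x + t *\<^sub>R e \<in> frontier (UNIV - imag_proj f)"
proof -
  let ?U = "UNIV - imag_proj f" and ?S = "range (\<lambda>t. x + t *\<^sub>R e)"
  have fe: "peval f (cvec_of_real e) \<noteq> 0"
    using real_zero_set_subset_imag_proj[OF f(1)] e by (auto simp: real_zero_set_def)
  have "connected ?S" by (intro connected_continuous_image continuous_intros) auto
  moreover have "?S \<inter> ?U \<noteq> {}"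
  proof -
    have "((\<lambda>s. e + s *\<^sub>R x) \<longlongrightarrow> e + 0 *\<^sub>R x) (at_right 0)" by (intro tendsto_intros)
    then have "eventually (\<lambda>s. e + s *\<^sub>R x \<in> ?U) (at_right 0)"
      using open_compl_imag_proj[OF f(1)] e by (intro topological_tendstoD) auto
    moreover have "eventually (\<lambda>s::real. s > 0) (at_right 0)" by (simp add: eventually_at_right_less)
    ultimately have "eventually (\<lambda>s. s > 0 \<and> e + s *\<^sub>R x \<in> ?U) (at_right 0)" by eventually_elim auto
    then obtain s where s: "s > 0" "e + s *\<^sub>R x \<in> ?U"
      using eventually_happens'[OF trivial_limit_at_right_real] by blast
    have "e + s *\<^sub>R x = s *\<^sub>R (x + inverse s *\<^sub>R e)" using s(1) by (simp add: algebra_simps)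
    moreover have "s *\<^sub>R (x + inverse s *\<^sub>R e) \<in> imag_proj f" if "x + inverse s *\<^sub>R e \<in> imag_proj f"
    proof (rule imag_proj_scale[OF f(1)])
      show "inverse s *\<^sub>R (s *\<^sub>R (x + inverse s *\<^sub>R e)) \<in> imag_proj f" using that s(1) by simp
    qed (use s(1) in simp)
    ultimately have "x + inverse s *\<^sub>R e \<in> ?U" using s(2) by auto
    then show ?thesis by blast
  qed
  moreover have "?S - ?U \<noteq> {}"
  proof -
    let ?q = "ueval (shift (cvec_of_real e) f) (cvec_of_real x)"
    have "coeff ?q d \<noteq> 0" using degree_shift(2)[OF f(1)] fe by simp
    then obtain t where "poly ?q t = 0" using f(2) by (rule poly_has_root)
    then have t: "peval f (cvec_of_real x + t *s cvec_of_real e) = 0" by simp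
    then have "Im t = 0" using imag_proj_line[OF f(1)] e by blast
    then have "t = of_real (Re t)" by (simp add: complex_eq_iff)
    then have "x + Re t *\<^sub>R e \<in> real_zero_set f" using t by (simp add: real_zero_set_def)
    then have "x + Re t *\<^sub>R e \<in> imag_proj f" using real_zero_set_subset_imag_proj[OF f(1)] by blast
    then show ?thesis by blast
  qed
  ultimately have "?S \<inter> frontier ?U \<noteq> {}" by (rule connected_Int_frontier)
  then show ?thesis by blast
qed

lemma zariski_closure_frontier:
  fixes f :: "'n::finite cpoly"
  assumes f: "homog d f" "irreducible f" and e: "hyperbolic_dir f e"
  shows "zariski_closure (cvec_of_real ` frontier (UNIV - imag_proj f)) = zero_set f"
proof
  let ?S = "frontier (UNIV - imag_proj f)"
  show "zariski_closure (cvec_of_real ` ?S) \<subseteq> zero_set f"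
    using frontier_compl_imag_proj[OF f(1)] by (auto simp: zariski_closure_def zero_set_def)
  have fe: "peval f (cvec_of_real e) \<noteq> 0" using e by (simp add: hyperbolic_dir_def)
  \<comment> \<open>Membership of \<open>e\<close> in the imaginary projection would give the
    nonreal root \<i> on some real line in direction \<open>e\<close>.\<close>
  have "\<i> \<notin> \<real>" by (simp add: complex_is_Real_iff)
  then have "e \<notin> imag_proj f" using e unfolding in_imag_proj_iff hyperbolic_dir_def by blast
  then have meets: "\<exists>t. x + t *\<^sub>R e \<in> ?S" for x
    using line_meets_frontier f irreducible_homog_degree_pos by blast
  show "zero_set f \<subseteq> zariski_closure (cvec_of_real ` ?S)"
    unfolding zariski_closure_def
  proof (intro subsetI CollectI allI impI)
    fix z and p :: "'n cpoly" assume z: "z \<in> zero_set f" and p: "\<forall>w\<in>cvec_of_real ` ?S. peval p w = 0"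
    have "f dvd p"
      by (rule vanishing_on_transversal_set[OF f fe frontier_compl_imag_proj[OF f(1)] meets]) (use p in auto)
    then obtain q where "p = f * q" by (rule dvdE)
    then show "peval p z = 0" using z by (simp add: zero_set_def)
  qed
qed

theorem theorem3p5:
  fixes f :: "'n::finite cpoly"
  assumes "f \<noteq> 0" and "homogeneous f"
  shows "real_zero_set f \<subseteq> imag_proj f
    \<and> (real_zero_set f = imag_proj f \<longleftrightarrow>
          (\<exists>\<phi>\<in>{0..<2*pi}. \<exists>ls. (\<forall>l\<in>set ls. real_linear_poly l) \<and>
              cconst (exp (\<i> * complex_of_real \<phi>)) * f = prod_list ls))
    \<and> ((\<exists>e. hyperbolic_dir f e) \<and> irreducible f \<longrightarrow>
          zariski_closure (cvec_of_real ` frontier (UNIV - imag_proj f)) = zero_set f)"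
proof -
  obtain d where d: "homog d f" using assms(2) unfolding homogeneous_iff by blast
  note sub = real_zero_set_subset_imag_proj[OF d]
  have "imag_proj f \<subseteq> real_zero_set f \<longleftrightarrow>
      (\<exists>\<phi>\<in>{0..<2*pi}. \<exists>ls. (\<forall>l\<in>set ls. real_linear_poly l) \<and>
              cconst (exp (\<i> * complex_of_real \<phi>)) * f = prod_list ls)"
  proof
    assume "imag_proj f \<subseteq> real_zero_set f"
    then show "\<exists>\<phi>\<in>{0..<2*pi}. \<exists>ls. (\<forall>l\<in>set ls. real_linear_poly l) \<and>
              cconst (exp (\<i> * complex_of_real \<phi>)) * f = prod_list ls"
      by (rule unit_multiple_real_linear_factorization[OF assms(1) d])
  next
    assume "\<exists>\<phi>\<in>{0..<2*pi}. \<exists>ls. (\<forall>l\<in>set ls. real_linear_poly l) \<and>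
              cconst (exp (\<i> * complex_of_real \<phi>)) * f = prod_list ls"
    then show "imag_proj f \<subseteq> real_zero_set f"
      using imag_proj_prod_real_linear[OF d] exp_not_eq_zero by blast
  qed
  moreover have "real_zero_set f = imag_proj f \<longleftrightarrow> imag_proj f \<subseteq> real_zero_set f" using sub by blast
  ultimately show ?thesis using sub zariski_closure_frontier[OF d] by metis
qed

end
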